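(* Let $(X,\mu)$ be a translation surface and let $f\in\operatorname{Aff}^+(X,\mu)$ with $A:=\operatorname{der}(f)$. Then the eigenvalues of $A$ are also eigenvalues of $M_f$.
   Context: Translation surface: $X$ is a compact Riemann surface of genus $g\ge 2$, $q\neq0$ a holomorphic quadratic differential on $X$, $X^*=X\setminus\{\text{zeros of }q\}$, such that the flat structure on $X^*$ given by the charts $P\mapsto\int\sqrt q$ contains an atlas $\mu$ of $X^*$ whose transition maps are locally of the form $z\mapsto z+c$ (the translation structure). $\operatorname{Aff}^+(X,\mu)$ is the group of orientation preserving homeomorphisms $f$ of $X$ that are affine with respect to $\mu$, i.e. of the form $z\mapsto Az+t$ in charts of $\mu$ (with $\mathbb{C}=\mathbb{R}^2$), $A\in\mathrm{SL}_2(\mathbb{R})$, $t\in\mathbb{C}$; the matrix $A$ does not depend on the charts and $\operatorname{der}(f):=A$. $M_f\in\mathbb{Z}^{2g\times 2g}$ is the matrix of the automorphism induced by $f$ on $\pi_1(X)^{ab}\cong H_1(X,\mathbb{Z})\cong\mathbb{Z}^{2g}$ with respect to the basis given by the classes of a set of generators $a_1,\dots,a_g,b_1,\dots,b_g$ with $\pi_1(X)=\langle a_1,b_1,\dots,a_g,b_g\mid\prod_{i=1}^g[a_i,b_i]\rangle$. Eigenvalues are taken over $\mathbb{C}$. *)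

theory Defs
  imports
    "HOL-Complex_Analysis.Complex_Analysis"
    "HOL-Homology.Homology"
    "Jordan_Normal_Form.Char_Poly"
begin

section \<open>Compact Riemann surfaces and quadratic differentials\<close>

text \<open>A chart is a pair of a domain and a complex coordinate; the coordinate is only meaningful
  on the domain.\<close>

type_synonym 'a chart = "'a set \<times> ('a \<Rightarrow> complex)"

definition complex_chart :: "'a topology \<Rightarrow> 'a chart \<Rightarrow> bool" where
  "complex_chart X = (\<lambda>(U, \<phi>).
     openin X U \<and> open (\<phi> ` U) \<and> homeomorphic_map (subtopology X U) (top_of_set (\<phi> ` U)) \<phi>)"

definition transition :: "'a chart \<Rightarrow> 'a chart \<Rightarrow> complex \<Rightarrow> complex" where
  "transition = (\<lambda>(U, \<phi>) (V, \<psi>). \<psi> \<circ> inv_into U \<phi>)"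

definition compact_riemann_surface :: "'a topology \<Rightarrow> 'a chart set \<Rightarrow> bool" where
  "compact_riemann_surface X \<A> \<longleftrightarrow>
     topspace X \<noteq> {} \<and> compact_space X \<and> connected_space X \<and> Hausdorff_space X \<and>
     (\<forall>\<alpha>\<in>\<A>. complex_chart X \<alpha>) \<and> \<Union> (fst ` \<A>) = topspace X \<and>
     (\<forall>(U, \<phi>)\<in>\<A>. \<forall>(V, \<psi>)\<in>\<A>. transition (U, \<phi>) (V, \<psi>) holomorphic_on \<phi> ` (U \<inter> V))"

text \<open>A quadratic differential is given by its coefficient functions: in the chart
  \<open>\<alpha> = (U, \<phi>)\<close> with coordinate \<open>z\<close> it is \<open>q \<alpha> z dz\<^sup>2\<close>.\<close>

definition holomorphic_quadratic_differential ::
    "'a chart set \<Rightarrow> ('a chart \<Rightarrow> complex \<Rightarrow> complex) \<Rightarrow> bool" where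
  "holomorphic_quadratic_differential \<A> q \<longleftrightarrow>
     (\<forall>(U, \<phi>)\<in>\<A>. q (U, \<phi>) holomorphic_on \<phi> ` U) \<and>
     (\<forall>(U, \<phi>)\<in>\<A>. \<forall>(V, \<psi>)\<in>\<A>. \<forall>P \<in> U \<inter> V.
        q (U, \<phi>) (\<phi> P) =
        q (V, \<psi>) (\<psi> P) * (deriv (transition (U, \<phi>) (V, \<psi>)) (\<phi> P))\<^sup>2)"

definition differential_zeros ::
    "'a chart set \<Rightarrow> ('a chart \<Rightarrow> complex \<Rightarrow> complex) \<Rightarrow> 'a set" where
  "differential_zeros \<A> q = {P. \<exists>(U, \<phi>)\<in>\<A>. P \<in> U \<and> q (U, \<phi>) (\<phi> P) = 0}"

section \<open>Translation surfaces\<close>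

text \<open>The charts \<open>P \<mapsto> \<integral> \<surd>q\<close> of the flat structure: in every complex coordinate,
  the chart is a primitive of a square root \<open>s\<close> of the coefficient of \<open>q\<close>.\<close>

definition flat_charts ::
    "'a topology \<Rightarrow> 'a chart set \<Rightarrow> ('a chart \<Rightarrow> complex \<Rightarrow> complex) \<Rightarrow> 'a chart set" where
  "flat_charts X \<A> q = {(U, \<zeta>).
     U \<subseteq> topspace X - differential_zeros \<A> q \<and> complex_chart X (U, \<zeta>) \<and>
     (\<forall>(V, \<phi>)\<in>\<A>. \<exists>s. \<forall>z \<in> \<phi> ` (U \<inter> V).
        (s z)\<^sup>2 = q (V, \<phi>) z \<and>
        (transition (V, \<phi>) (U, \<zeta>) has_field_derivative s z) (at z))}"

text \<open>An atlas of \<open>X\<close> minus the zeros of \<open>q\<close>, contained in the flat structure, all of whose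
  transition maps are locally of the form \<open>z \<mapsto> z + c\<close>.\<close>

definition translation_structure ::
    "'a topology \<Rightarrow> 'a chart set \<Rightarrow> ('a chart \<Rightarrow> complex \<Rightarrow> complex) \<Rightarrow> 'a chart set \<Rightarrow> bool" where
  "translation_structure X \<A> q \<mu> \<longleftrightarrow>
     \<mu> \<subseteq> flat_charts X \<A> q \<and>
     \<Union> (fst ` \<mu>) = topspace X - differential_zeros \<A> q \<and>
     (\<forall>(U, \<zeta>)\<in>\<mu>. \<forall>(V, \<xi>)\<in>\<mu>. \<forall>P \<in> U \<inter> V. \<exists>c W.
        openin X W \<and> P \<in> W \<and> W \<subseteq> U \<inter> V \<and> (\<forall>Q\<in>W. \<xi> Q = \<zeta> Q + c))"

definition translation_surface ::
    "'a topology \<Rightarrow> 'a chart set \<Rightarrow> ('a chart \<Rightarrow> complex \<Rightarrow> complex) \<Rightarrow> 'a chart set \<Rightarrow> bool" where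
  "translation_surface X \<A> q \<mu> \<longleftrightarrow>
     compact_riemann_surface X \<A> \<and>
     holomorphic_quadratic_differential \<A> q \<and>
     (\<exists>(U, \<phi>)\<in>\<A>. \<exists>z \<in> \<phi> ` U. q (U, \<phi>) z \<noteq> 0) \<and>
     translation_structure X \<A> q \<mu>"

section \<open>Affine homeomorphisms and their derivative\<close>

text \<open>The action of a real \<open>2 \<times> 2\<close> matrix on the complex plane, identified with the real plane.\<close>

definition plane_action :: "real mat \<Rightarrow> complex \<Rightarrow> complex" where
  "plane_action A z =
     Complex (A $$ (0,0) * Re z + A $$ (0,1) * Im z) (A $$ (1,0) * Re z + A $$ (1,1) * Im z)"

definition SL2R :: "real mat set" where
  "SL2R = {A \<in> carrier_mat 2 2. Determinant.det A = 1}"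

definition affine_near ::
    "'a topology \<Rightarrow> ('a \<Rightarrow> 'a) \<Rightarrow> 'a chart \<Rightarrow> 'a chart \<Rightarrow> real mat \<Rightarrow> 'a \<Rightarrow> bool" where
  "affine_near X f = (\<lambda>(U, \<zeta>) (V, \<xi>) A P. \<exists>t W.
     openin X W \<and> P \<in> W \<and> W \<subseteq> U \<and> f ` W \<subseteq> V \<and>
     (\<forall>Q\<in>W. \<xi> (f Q) = plane_action A (\<zeta> Q) + t))"

text \<open>Being orientation preserving is no separate condition: it is contained in \<open>det A = 1\<close>.
  The union of the domains of \<open>\<mu>\<close> is the complement of the zeros of \<open>q\<close>. A priori the matrix
  may depend on the charts and on the point.\<close>

definition affine_group :: "'a topology \<Rightarrow> 'a chart set \<Rightarrow> ('a \<Rightarrow> 'a) set" where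
  "affine_group X \<mu> = {f.
     homeomorphic_map X X f \<and> f ` \<Union> (fst ` \<mu>) = \<Union> (fst ` \<mu>) \<and>
     (\<forall>\<alpha>\<in>\<mu>. \<forall>\<beta>\<in>\<mu>. \<forall>P \<in> fst \<alpha>. f P \<in> fst \<beta> \<longrightarrow> (\<exists>A\<in>SL2R. affine_near X f \<alpha> \<beta> A P))}"

definition der :: "'a topology \<Rightarrow> 'a chart set \<Rightarrow> ('a \<Rightarrow> 'a) \<Rightarrow> real mat" where
  "der X \<mu> f = (THE A. A \<in> SL2R \<and>
     (\<forall>\<alpha>\<in>\<mu>. \<forall>\<beta>\<in>\<mu>. \<forall>P \<in> fst \<alpha>. f P \<in> fst \<beta> \<longrightarrow> affine_near X f \<alpha> \<beta> A P))"

section \<open>Group presentations\<close>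

text \<open>The letter \<open>(i, True)\<close> stands for the generator with index \<open>i\<close>, and \<open>(i, False)\<close> for its
  inverse.\<close>

type_synonym 'i word = "('i \<times> bool) list"

definition word_value :: "('g, 'b) monoid_scheme \<Rightarrow> ('i \<Rightarrow> 'g) \<Rightarrow> 'i word \<Rightarrow> 'g" where
  "word_value G c w =
     foldr (\<lambda>(i, s) x. (if s then c i else inv\<^bsub>G\<^esub> (c i)) \<otimes>\<^bsub>G\<^esub> x) w \<one>\<^bsub>G\<^esub>"

text \<open>Equality of words in the group with the given generators and relators \<open>R\<close>.\<close>

inductive word_equiv :: "'i word set \<Rightarrow> 'i word \<Rightarrow> 'i word \<Rightarrow> bool" for R where
  refl: "word_equiv R u u"
| sym: "word_equiv R u v \<Longrightarrow> word_equiv R v u"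
| trans: "word_equiv R u v \<Longrightarrow> word_equiv R v w \<Longrightarrow> word_equiv R u w"
| cancel: "word_equiv R (u @ [(i, s), (i, \<not> s)] @ v) (u @ v)"
| relator: "r \<in> R \<Longrightarrow> word_equiv R (u @ r @ v) (u @ v)"

definition has_presentation ::
    "('g, 'b) monoid_scheme \<Rightarrow> 'i set \<Rightarrow> ('i \<Rightarrow> 'g) \<Rightarrow> 'i word set \<Rightarrow> bool" where
  "has_presentation G I c R \<longleftrightarrow>
     c ` I \<subseteq> carrier G \<and>
     (\<forall>x \<in> carrier G. \<exists>w. fst ` set w \<subseteq> I \<and> word_value G c w = x) \<and>
     (\<forall>w. fst ` set w \<subseteq> I \<longrightarrow> (word_value G c w = \<one>\<^bsub>G\<^esub> \<longleftrightarrow> word_equiv R w []))"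

section \<open>The fundamental group and the first homology group\<close>

text \<open>The library's path operations need a topological type class; the following are their
  counterparts for an arbitrary topology.\<close>

definition loops :: "'a topology \<Rightarrow> 'a \<Rightarrow> (real \<Rightarrow> 'a) set" where
  "loops X x = {p. pathin X p \<and> p 0 = x \<and> p 1 = x}"

definition loop_join :: "(real \<Rightarrow> 'a) \<Rightarrow> (real \<Rightarrow> 'a) \<Rightarrow> real \<Rightarrow> 'a" where
  "loop_join p q = (\<lambda>t. if t \<le> 1/2 then p (2 * t) else q (2 * t - 1))"

definition loop_homotopic :: "'a topology \<Rightarrow> 'a \<Rightarrow> (real \<Rightarrow> 'a) \<Rightarrow> (real \<Rightarrow> 'a) \<Rightarrow> bool" where
  "loop_homotopic X x = homotopic_with (\<lambda>r. r 0 = x \<and> r 1 = x) (top_of_set {0..1}) X"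

definition homotopy_class :: "'a topology \<Rightarrow> 'a \<Rightarrow> (real \<Rightarrow> 'a) \<Rightarrow> (real \<Rightarrow> 'a) set" where
  "homotopy_class X x p = {r. loop_homotopic X x p r}"

definition fundamental_group :: "'a topology \<Rightarrow> 'a \<Rightarrow> (real \<Rightarrow> 'a) set monoid" where
  "fundamental_group X x =
     \<lparr>carrier = homotopy_class X x ` loops X x,
      monoid.mult = (\<lambda>C D. \<Union>p\<in>C. \<Union>q\<in>D. homotopy_class X x (loop_join p q)),
      one = homotopy_class X x (\<lambda>_. x)\<rparr>"

text \<open>The family \<open>a\<^sub>1, \<dots>, a\<^sub>g, b\<^sub>1, \<dots>, b\<^sub>g\<close>, indexed from 0.\<close>

definition generator_family :: "nat \<Rightarrow> (nat \<Rightarrow> 'b) \<Rightarrow> (nat \<Rightarrow> 'b) \<Rightarrow> nat \<Rightarrow> 'b" where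
  "generator_family g a b j = (if j < g then a j else b (j - g))"

text \<open>The word \<open>[a\<^sub>1, b\<^sub>1] \<cdots> [a\<^sub>g, b\<^sub>g]\<close>.\<close>

definition surface_relator :: "nat \<Rightarrow> nat word" where
  "surface_relator g =
     concat (map (\<lambda>i. [(i, True), (g + i, True), (i, False), (g + i, False)]) [0..<g])"

definition standard_generators ::
    "'a topology \<Rightarrow> 'a \<Rightarrow> nat \<Rightarrow> (nat \<Rightarrow> real \<Rightarrow> 'a) \<Rightarrow> (nat \<Rightarrow> real \<Rightarrow> 'a) \<Rightarrow> bool" where
  "standard_generators X x g a b \<longleftrightarrow>
     (\<forall>i<g. a i \<in> loops X x \<and> b i \<in> loops X x) \<and>
     has_presentation (fundamental_group X x) {..<2*g}
       (\<lambda>j. homotopy_class X x (generator_family g a b j)) {surface_relator g}"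

text \<open>Topological genus: the first Betti number of the closed surface \<open>X\<close> is \<open>2g\<close>.\<close>

definition has_genus :: "'a topology \<Rightarrow> nat \<Rightarrow> bool" where
  "has_genus X g \<longleftrightarrow> homology_group 1 X \<cong> free_Abelian_group {..<2*g}"

text \<open>The image of a loop under the Hurewicz map: the class of the singular 1-simplex obtained by
  identifying the standard simplex with the unit interval.\<close>

definition loop_class :: "'a topology \<Rightarrow> (real \<Rightarrow> 'a) \<Rightarrow> 'a chain set" where
  "loop_class X p =
     homologous_rel_set 1 X {} (frag_of (restrict (\<lambda>x. p (x 1)) (standard_simplex 1)))"

text \<open>\<open>M\<close> is the matrix of the automorphism of \<open>H\<^sub>1(X, \<int>)\<close> induced by \<open>f\<close>, with respect to the
  classes of the loops \<open>a\<^sub>1, \<dots>, a\<^sub>g, b\<^sub>1, \<dots>, b\<^sub>g\<close>. For standard generators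
  these classes are a basis, so that \<open>M\<close> exists and is unique. The homology group is written
  multiplicatively, and the coordinates of the image of the \<open>j\<close>-th class form column \<open>j\<close>.\<close>

definition is_homology_matrix ::
    "'a topology \<Rightarrow> nat \<Rightarrow> (nat \<Rightarrow> real \<Rightarrow> 'a) \<Rightarrow> (nat \<Rightarrow> real \<Rightarrow> 'a) \<Rightarrow> ('a \<Rightarrow> 'a) \<Rightarrow> int mat \<Rightarrow> bool"
  where
  "is_homology_matrix X g a b f M \<longleftrightarrow>
     M \<in> carrier_mat (2*g) (2*g) \<and>
     (\<forall>j<2*g. hom_induced 1 X {} X {} f (loop_class X (generator_family g a b j)) =
        finprod (homology_group 1 X)
          (\<lambda>i. loop_class X (generator_family g a b i) [^]\<^bsub>homology_group 1 X\<^esub> (M $$ (i, j)))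
          {..<2*g})"

end

theory Submission
  imports Defs
begin

text \<open>
  The charts of the translation structure differ by constants, so their differentials fit together
  to a holomorphic one-form \<open>\<omega>\<close> off the zeros of \<open>q\<close>. Since \<open>\<omega>\<^sup>2 = q\<close>, it is bounded near the zeros
  and hence extends over them. An affine homeomorphism \<open>f\<close> with derivative \<open>A\<close> satisfies
  \<open>\<integral>\<^bsub>f \<circ> c\<^esub> \<omega> = A (\<integral>\<^bsub>c\<^esub> \<omega>)\<close> for every loop \<open>c\<close>, where \<open>A\<close> acts on the plane. If \<open>\<omega>\<^sub>j\<close> is the period of
  \<open>\<omega>\<close> over the \<open>j\<close>-th generator, and \<open>P\<close> is the real \<open>2 \<times> 2g\<close> matrix with the columns \<open>\<omega>\<^sub>j\<close>, this reads
  \<open>A P = P M\<close>. A left eigenvector \<open>v\<close> of \<open>A\<close> gives \<open>(v P) M = z (v P)\<close>, so \<open>v P\<close> is a left eigenvector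
  of \<open>M\<close> as soon as it is nonzero. This holds because the rows of \<open>P\<close> are linearly independent: if
  a nonzero real linear form \<open>L\<close> vanished on all periods, then \<open>L\<close> of the integral of \<open>\<omega>\<close> from a
  base point would be a continuous function on the compact surface, and at its maximum it would
  contradict the open mapping theorem.

  Paths, homotopies and singular simplices are merely continuous, so \<open>\<omega>\<close> cannot be pulled
  back along them. Integration is therefore based on local primitives only (locale
  \<open>local_primitives\<close>): a primitive along a path is a function on the parameter interval whose
  increments are locally those of a local primitive. Existence and uniqueness follow by
  bisection of the interval, and \<open>path_integral_rectangle\<close> follows by bisection of a rectangle.
  The latter is the only form of Stokes' theorem that is needed: it gives
  homotopy invariance (\<open>path_integral_homotopic\<close>) and, for a triangle seen as a collapsed
  rectangle, the vanishing of the integral over boundaries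
  (\<open>chain_integral_boundary_simplex\<close>), so that the integral depends on the homology class only.

  The local primitives on the surface are constructed in \<open>primitive_on_disc\<close>; the locale's
  compatibility condition, the equivariance \<open>primitives_affine\<close>, and the
  independence of the linear part of \<open>f\<close> of the point are all first seen off the zeros of \<open>q\<close>,
  where everything is affine in the charts, and then carried over the zeros, which are isolated
  (\<open>locally_constant_removable\<close>, \<open>constant_off_zeros\<close>). The independence of the rows of \<open>P\<close> is
  \<open>periods_span_plane\<close> combined with \<open>path_integral_in_subgroup\<close>, which reduces the periods over all
  loops to those over the generators.\<close>

section \<open>Integration along continuous paths from local primitives\<close>

lemma continuous_map_nearby:
  fixes S :: "'m::metric_space set"
  assumes "continuous_map (top_of_set S) X p" and "t \<in> S" and "openin X U" and "p t \<in> U"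
  obtains e where "e > 0" and "\<And>s. s \<in> S \<Longrightarrow> dist s t < e \<Longrightarrow> p s \<in> U"
proof -
  have "openin (top_of_set S) {s \<in> S. p s \<in> U}"
    using openin_continuous_map_preimage[OF assms(1,3)] by simp
  then obtain e where "e > 0" "\<forall>s\<in>S. dist s t < e \<longrightarrow> s \<in> {s \<in> S. p s \<in> U}"
    using assms(2,4) by (force simp: openin_euclidean_subtopology_iff)
  with that show thesis by auto
qed

text \<open>A closed one-form, given by the germs of its primitives. Two primitives may differ by a locally
  constant function; only their increments carry information.\<close>

locale local_primitives =
  fixes X :: "'a topology" and Fs :: "('a set \<times> ('a \<Rightarrow> complex)) set"
  assumes open_dom: "(U, F) \<in> Fs \<Longrightarrow> openin X U"
    and cover: "P \<in> topspace X \<Longrightarrow> \<exists>U F. (U, F) \<in> Fs \<and> P \<in> U"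
    and compat: "(U, F) \<in> Fs \<Longrightarrow> (V, G) \<in> Fs \<Longrightarrow> P \<in> U \<Longrightarrow> P \<in> V \<Longrightarrow>
      \<exists>W. openin X W \<and> P \<in> W \<and> W \<subseteq> U \<inter> V \<and> (\<forall>Q\<in>W. F Q - F P = G Q - G P)"
begin

definition primitive_along :: "(real \<Rightarrow> 'a) \<Rightarrow> real set \<Rightarrow> (real \<Rightarrow> complex) \<Rightarrow> bool" where
  "primitive_along p S G \<longleftrightarrow> (\<forall>t\<in>S. \<exists>U F e. (U, F) \<in> Fs \<and> e > 0 \<and>
     (\<forall>s\<in>S. dist s t < e \<longrightarrow> p s \<in> U \<and> G s - G t = F (p s) - F (p t)))"

text \<open>The primitive in the definition may be exchanged for any other one defined near the point,
  because the two have the same increments there.\<close>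

lemma primitive_alongD:
  assumes "primitive_along p S G" and "continuous_map (top_of_set S) X p"
    and "t \<in> S" and "(U, F) \<in> Fs" and "p t \<in> U"
  shows "\<exists>e>0. \<forall>s\<in>S. dist s t < e \<longrightarrow> p s \<in> U \<and> G s - G t = F (p s) - F (p t)"
proof -
  obtain V H e where V: "(V, H) \<in> Fs" and e: "e > 0"
    "\<And>s. s \<in> S \<Longrightarrow> dist s t < e \<Longrightarrow> p s \<in> V \<and> G s - G t = H (p s) - H (p t)"
    using assms(1,3) unfolding primitive_along_def by meson
  have "p t \<in> V" using e assms(3) by auto
  then obtain W where W: "openin X W" "p t \<in> W" "W \<subseteq> V \<inter> U" "\<forall>Q\<in>W. H Q - H (p t) = F Q - F (p t)"
    using compat[OF V assms(4)] assms(5) by blast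
  obtain d where d: "d > 0" "\<And>s. s \<in> S \<Longrightarrow> dist s t < d \<Longrightarrow> p s \<in> W"
    using continuous_map_nearby[OF assms(2,3) W(1,2)] by blast
  have "p s \<in> U \<and> G s - G t = F (p s) - F (p t)" if "s \<in> S" "dist s t < min d e" for s
  proof -
    have "p s \<in> W" using that d(2) by simp
    then have "p s \<in> U" "H (p s) - H (p t) = F (p s) - F (p t)" using W(3,4) by blast+
    then show ?thesis using that e(2) by simp
  qed
  moreover have "min d e > 0" using d(1) e(1) by simp
  ultimately show ?thesis by blast
qed

lemma primitive_along_in_domain:
  assumes "(U, F) \<in> Fs" and "\<And>s. s \<in> S \<Longrightarrow> p s \<in> U"
  shows "primitive_along p S (\<lambda>s. F (p s))"
  unfolding primitive_along_def using assms by (intro ballI exI[of _ U] exI[of _ F] exI[of _ 1]) auto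

lemma primitive_along_subset: "primitive_along p S G \<Longrightarrow> T \<subseteq> S \<Longrightarrow> primitive_along p T G"
  unfolding primitive_along_def by (meson subsetD)

lemma primitive_along_cong:
  assumes "primitive_along p S G" and "\<And>s. s \<in> S \<Longrightarrow> p s = r s"
  shows "primitive_along r S G"
  using assms unfolding primitive_along_def by simp

lemma primitive_along_reparam:
  assumes "primitive_along p S G" and "continuous_on T \<phi>" and "\<phi> ` T \<subseteq> S"
  shows "primitive_along (\<lambda>t. p (\<phi> t)) T (\<lambda>t. G (\<phi> t))"
  unfolding primitive_along_def
proof
  fix t assume t: "t \<in> T"
  then have "\<phi> t \<in> S" using assms(3) by blast
  then obtain U F e where U: "(U, F) \<in> Fs" and e: "e > 0"
    "\<forall>s\<in>S. dist s (\<phi> t) < e \<longrightarrow> p s \<in> U \<and> G s - G (\<phi> t) = F (p s) - F (p (\<phi> t))"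
    using assms(1) unfolding primitive_along_def by blast
  obtain d where "d > 0" "\<forall>s\<in>T. dist s t < d \<longrightarrow> dist (\<phi> s) (\<phi> t) < e"
    using assms(2) t e(1) unfolding continuous_on_iff by meson
  with U e assms(3) show "\<exists>U F e. (U, F) \<in> Fs \<and> e > 0 \<and> (\<forall>s\<in>T. dist s t < e \<longrightarrow>
      p (\<phi> s) \<in> U \<and> G (\<phi> s) - G (\<phi> t) = F (p (\<phi> s)) - F (p (\<phi> t)))"
    by (intro exI[of _ U] exI[of _ F] exI[of _ d]) auto
qed

text \<open>Two primitives along a path have equal increments over all short intervals around any given
  parameter, and equality of increments is additive under juxtaposition of intervals; so bisection
  applies.\<close>

lemma primitive_along_unique:
  assumes "a \<le> b" and cont: "continuous_map (top_of_set {a..b}) X p"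
    and G: "primitive_along p {a..b} G" and H: "primitive_along p {a..b} H"
  shows "G b - G a = H b - H a"
proof -
  define D where "D c d \<longleftrightarrow> (a \<le> c \<and> c \<le> d \<and> d \<le> b \<longrightarrow> G d - G c = H d - H c)" for c d
  have "D a b" using \<open>a \<le> b\<close>
  proof (induction rule: Bolzano)
    case (trans u v w)
    then show ?case unfolding D_def by (smt (verit) add_diff_cancel_left' diff_add_cancel diff_diff_eq2)
  next
    case (local t)
    then have t: "t \<in> {a..b}" by auto
    have "p t \<in> topspace X" using cont t by (auto simp: continuous_map_def)
    then obtain U F where UF: "(U, F) \<in> Fs" "p t \<in> U" using cover by blast
    obtain e where e: "e > 0" "\<And>s. s \<in> {a..b} \<Longrightarrow> dist s t < e \<Longrightarrow> p s \<in> U \<and> G s - G t = F (p s) - F (p t)"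
      using primitive_alongD[OF G cont t UF] by blast
    obtain d where d: "d > 0" "\<And>s. s \<in> {a..b} \<Longrightarrow> dist s t < d \<Longrightarrow> p s \<in> U \<and> H s - H t = F (p s) - F (p t)"
      using primitive_alongD[OF H cont t UF] by blast
    have "D u v" if "u \<le> t" "t \<le> v" "v - u < min d e" for u v
      unfolding D_def
    proof
      assume uv: "a \<le> u \<and> u \<le> v \<and> v \<le> b"
      have "dist u t < min d e" "dist v t < min d e" using that by (auto simp: dist_real_def)
      then have "G u - G t = H u - H t" "G v - G t = H v - H t"
        using d(2)[of u] e(2)[of u] d(2)[of v] e(2)[of v] uv that by auto
      then show "G v - G u = H v - H u" by (metis diff_diff_eq2 diff_add_cancel)
    qed
    then show ?case using d(1) e(1) by (metis min_less_iff_conj)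
  qed
  then show ?thesis using assms(1) unfolding D_def by simp
qed

text \<open>On a short interval the path stays in the domain of one local primitive, which is composed with
  the path. Adjacent intervals are glued after adjusting the additive constant of the second part;
  at the common end point, both parts are compared with the same local primitive.\<close>

lemma primitive_along_exists:
  assumes "a \<le> b" and cont: "continuous_map (top_of_set {a..b}) X p"
  shows "\<exists>G. primitive_along p {a..b} G"
proof -
  define D where "D c d \<longleftrightarrow> (a \<le> c \<and> c \<le> d \<and> d \<le> b \<longrightarrow> (\<exists>G. primitive_along p {c..d} G))" for c d
  have sub: "continuous_map (top_of_set {c..d}) X p" if "a \<le> c" "d \<le> b" for c d
    using cont continuous_map_from_subtopology_mono[of euclidean "{a..b}" X p "{c..d}"] that by auto
  have "D a b" using \<open>a \<le> b\<close>
  proof (induction rule: Bolzano)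
    case (trans u v w)
    show ?case unfolding D_def
    proof
      assume *: "a \<le> u \<and> u \<le> w \<and> w \<le> b"
      then obtain G H where G: "primitive_along p {u..v} G" and H: "primitive_along p {v..w} H"
        using trans unfolding D_def by (meson order_trans)
      define K where "K s = (if s \<le> v then G s else H s - H v + G v)" for s
      have "primitive_along p {u..w} K"
        unfolding primitive_along_def
      proof
        fix t assume t: "t \<in> {u..w}"
        have "p t \<in> topspace X" using cont t * by (auto simp: continuous_map_def)
        then obtain U F where UF: "(U, F) \<in> Fs" "p t \<in> U" using cover by blast
        have L: "\<exists>e>0. \<forall>s\<in>{u..v}. dist s t < e \<longrightarrow> p s \<in> U \<and> G s - G t = F (p s) - F (p t)" if "t \<le> v"
        proof -
          have "t \<in> {u..v}" "continuous_map (top_of_set {u..v}) X p"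
            using sub[of u v] t that trans * by auto
          from primitive_alongD[OF G this(2,1) UF] show ?thesis .
        qed
        have R: "\<exists>e>0. \<forall>s\<in>{v..w}. dist s t < e \<longrightarrow> p s \<in> U \<and> H s - H t = F (p s) - F (p t)" if "v \<le> t"
        proof -
          have "t \<in> {v..w}" "continuous_map (top_of_set {v..w}) X p"
            using sub[of v w] t that trans * by auto
          from primitive_alongD[OF H this(2,1) UF] show ?thesis .
        qed
        consider "t < v" | "t = v" | "t > v" by linarith
        then have "\<exists>e>0. \<forall>s\<in>{u..w}. dist s t < e \<longrightarrow> p s \<in> U \<and> K s - K t = F (p s) - F (p t)"
        proof cases
          case 1
          then have "t \<le> v" by simp
          then obtain e where e: "e > 0" "\<forall>s\<in>{u..v}. dist s t < e \<longrightarrow> p s \<in> U \<and> G s - G t = F (p s) - F (p t)"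
            using L by blast
          have "p s \<in> U \<and> K s - K t = F (p s) - F (p t)"
            if "s \<in> {u..w}" "dist s t < min e (v - t)" for s
          proof -
            have "s \<in> {u..v}" "s \<le> v" using that 1 by (auto simp: dist_real_def)
            then show ?thesis using e(2) that 1 by (simp add: K_def)
          qed
          moreover have "min e (v - t) > 0" using e(1) 1 by simp
          ultimately show ?thesis by blast
        next
          case 2
          then have "t \<le> v" "v \<le> t" by simp_all
          then obtain e d where e: "e > 0" "\<forall>s\<in>{u..v}. dist s t < e \<longrightarrow> p s \<in> U \<and> G s - G t = F (p s) - F (p t)"
            and d: "d > 0" "\<forall>s\<in>{v..w}. dist s t < d \<longrightarrow> p s \<in> U \<and> H s - H t = F (p s) - F (p t)"
            using L R by blast
          have "p s \<in> U \<and> K s - K t = F (p s) - F (p t)"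
            if s: "s \<in> {u..w}" "dist s t < min e d" for s
          proof (cases "s \<le> v")
            case True
            then have "s \<in> {u..v}" using s by simp
            then show ?thesis using e(2) s True 2 by (simp add: K_def)
          next
            case False
            then have "s \<in> {v..w}" using s by simp
            then show ?thesis using d(2) s False 2 by (simp add: K_def)
          qed
          moreover have "min e d > 0" using e(1) d(1) by simp
          ultimately show ?thesis by blast
        next
          case 3
          then have "v \<le> t" by simp
          then obtain d where d: "d > 0" "\<forall>s\<in>{v..w}. dist s t < d \<longrightarrow> p s \<in> U \<and> H s - H t = F (p s) - F (p t)"
            using R by blast
          have "p s \<in> U \<and> K s - K t = F (p s) - F (p t)"
            if "s \<in> {u..w}" "dist s t < min d (t - v)" for s
          proof -
            have "s \<in> {v..w}" "\<not> s \<le> v" using that 3 by (auto simp: dist_real_def)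
            then show ?thesis using d(2) that 3 by (simp add: K_def)
          qed
          moreover have "min d (t - v) > 0" using d(1) 3 by simp
          ultimately show ?thesis by blast
        qed
        then show "\<exists>U F e. (U, F) \<in> Fs \<and> e > 0 \<and> (\<forall>s\<in>{u..w}. dist s t < e \<longrightarrow> p s \<in> U \<and> K s - K t = F (p s) - F (p t))"
          using UF(1) by blast
      qed
      then show "\<exists>G. primitive_along p {u..w} G" by blast
    qed
  next
    case (local t)
    then have t: "t \<in> {a..b}" by auto
    have "p t \<in> topspace X" using cont t by (auto simp: continuous_map_def)
    then obtain U F where UF: "(U, F) \<in> Fs" "p t \<in> U" using cover by blast
    obtain d where d: "d > 0" "\<And>s. s \<in> {a..b} \<Longrightarrow> dist s t < d \<Longrightarrow> p s \<in> U"
      using continuous_map_nearby[OF cont t open_dom[OF UF(1)] UF(2)] by blast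
    have "D u v" if "u \<le> t" "t \<le> v" "v - u < d" for u v
      unfolding D_def
    proof
      assume "a \<le> u \<and> u \<le> v \<and> v \<le> b"
      then have "primitive_along p {u..v} (\<lambda>s. F (p s))"
        using that by (intro primitive_along_in_domain[OF UF(1)] d(2)) (auto simp: dist_real_def)
      then show "\<exists>G. primitive_along p {u..v} G" by blast
    qed
    then show ?case using d(1) by blast
  qed
  then show ?thesis using assms(1) unfolding D_def by simp
qed

definition path_integral :: "(real \<Rightarrow> 'a) \<Rightarrow> real \<Rightarrow> real \<Rightarrow> complex" where
  "path_integral p a b = (let G = SOME G. primitive_along p {a..b} G in G b - G a)"

lemma path_integral_eq:
  assumes "a \<le> b" and "continuous_map (top_of_set {a..b}) X p" and "primitive_along p {a..b} G"
  shows "path_integral p a b = G b - G a"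
  unfolding path_integral_def Let_def
  using primitive_along_unique[OF assms(1,2) someI[of "primitive_along p {a..b}", OF assms(3)] assms(3)] .

lemma path_integral_split:
  assumes "a \<le> b" and "b \<le> c" and cont: "continuous_map (top_of_set {a..c}) X p"
  shows "path_integral p a c = path_integral p a b + path_integral p b c"
proof -
  obtain G where G: "primitive_along p {a..c} G"
    using primitive_along_exists[OF _ cont] assms(1,2) by auto
  have sub: "{a..b} \<subseteq> {a..c}" "{b..c} \<subseteq> {a..c}" using assms by auto
  show ?thesis
    using path_integral_eq[OF _ cont G]
      path_integral_eq[OF assms(1) continuous_map_from_subtopology_mono[OF cont sub(1)] primitive_along_subset[OF G sub(1)]]
      path_integral_eq[OF assms(2) continuous_map_from_subtopology_mono[OF cont sub(2)] primitive_along_subset[OF G sub(2)]]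
      assms(1,2)
    by simp
qed

lemma path_integral_in_domain:
  assumes "a \<le> b" and "continuous_map (top_of_set {a..b}) X p" and "(U, F) \<in> Fs"
    and "\<And>s. s \<in> {a..b} \<Longrightarrow> p s \<in> U"
  shows "path_integral p a b = F (p b) - F (p a)"
  using path_integral_eq[OF assms(1,2) primitive_along_in_domain[OF assms(3,4)]] .

lemma path_integral_cong:
  assumes "\<And>s. s \<in> {a..b} \<Longrightarrow> p s = r s"
  shows "path_integral p a b = path_integral r a b"
proof -
  have "primitive_along p {a..b} = primitive_along r {a..b}"
    using primitive_along_cong[of p "{a..b}" _ r] primitive_along_cong[of r "{a..b}" _ p] assms
      by fastforce
  then show ?thesis unfolding path_integral_def by simp
qed

lemma path_integral_reparam:
  assumes "a \<le> b" and "c \<le> d" and p: "continuous_map (top_of_set {c..d}) X p"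
    and \<phi>: "continuous_on {a..b} \<phi>" "\<phi> ` {a..b} \<subseteq> {c..d}" "\<phi> a = c" "\<phi> b = d"
  shows "path_integral (\<lambda>t. p (\<phi> t)) a b = path_integral p c d"
proof -
  obtain G where G: "primitive_along p {c..d} G" using primitive_along_exists[OF assms(2) p] by blast
  have "continuous_map (top_of_set {a..b}) (top_of_set {c..d}) \<phi>" using \<phi>(1,2) by auto
  from continuous_map_compose[OF this p] have "continuous_map (top_of_set {a..b}) X (\<lambda>t. p (\<phi> t))"
    by (simp add: o_def)
  from path_integral_eq[OF assms(1) this primitive_along_reparam[OF G \<phi>(1,2)]]
    path_integral_eq[OF assms(2) p G] \<phi>(3,4)
  show ?thesis by simp
qed

lemma path_integral_reverse:
  assumes p: "pathin X p"
  shows "path_integral (\<lambda>t. p (1 - t)) 0 1 = - path_integral p 0 1"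
proof -
  have p: "continuous_map (top_of_set {0..1}) X p" using p by (simp add: pathin_def)
  obtain G where G: "primitive_along p {0..1} G" using primitive_along_exists[OF _ p] by auto
  have \<phi>: "continuous_on {0..1::real} (\<lambda>t. 1 - t)" "(\<lambda>t. 1 - t) ` {0..1::real} \<subseteq> {0..1}"
    by (auto intro!: continuous_intros)
  have "continuous_map (top_of_set {0..1}) (top_of_set {0..1::real}) (\<lambda>t. 1 - t)"
    using \<phi> by auto
  from continuous_map_compose[OF this p] have "continuous_map (top_of_set {0..1}) X (\<lambda>t. p (1 - t))"
    by (simp add: o_def)
  from path_integral_eq[OF _ this primitive_along_reparam[OF G \<phi>]] path_integral_eq[OF _ p G]
  show ?thesis by simp
qed

lemma path_integral_const:
  assumes "x \<in> topspace X" and "a \<le> b"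
  shows "path_integral (\<lambda>_. x) a b = 0"
proof -
  obtain U F where "(U, F) \<in> Fs" "x \<in> U" using cover[OF assms(1)] by blast
  from path_integral_in_domain[OF assms(2) _ this(1), of "\<lambda>_. x"] this(2) assms(1) show ?thesis
    by simp
qed

end

section \<open>Rectangles, homotopies and concatenation\<close>

lemma pathin_join:
  assumes "pathin X p" and "pathin X r" and "p 1 = r 0"
  shows "pathin X (loop_join p r)"
proof -
  have half: "continuous_map (top_of_set {0..1/2}) (top_of_set {0..1::real}) (\<lambda>t. 2 * t)"
    "continuous_map (top_of_set {1/2..1}) (top_of_set {0..1::real}) (\<lambda>t. 2 * t - 1)"
    by (auto intro!: continuous_intros)
  have "continuous_map (top_of_set {0..1}) X (\<lambda>t. if t \<le> 1/2 then p (2 * t) else r (2 * t - 1))"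
  proof (rule continuous_map_cases_le)
    show "continuous_map (subtopology (top_of_set {0..1}) {t \<in> topspace (top_of_set {0..1}). t \<le> 1 / 2}) X (\<lambda>t. p (2 * t))"
    proof -
      have "subtopology (top_of_set {0..1}) {t \<in> topspace (top_of_set {0..1}). t \<le> 1 / 2} = top_of_set {0..1/2::real}"
        by (simp add: subtopology_subtopology) (rule arg_cong[where f="subtopology _"], auto)
      then show ?thesis
        using continuous_map_compose[OF half(1) assms(1)[unfolded pathin_def]] by (simp add: o_def)
    qed
    show "continuous_map (subtopology (top_of_set {0..1}) {t \<in> topspace (top_of_set {0..1}). 1 / 2 \<le> t}) X (\<lambda>t. r (2 * t - 1))"
    proof -
      have "subtopology (top_of_set {0..1}) {t \<in> topspace (top_of_set {0..1}). 1 / 2 \<le> t} = top_of_set {1/2..1::real}"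
        by (simp add: subtopology_subtopology) (rule arg_cong[where f="subtopology _"], auto)
      then show ?thesis
        using continuous_map_compose[OF half(2) assms(2)[unfolded pathin_def]] by (simp add: o_def)
    qed
  qed (use assms(3) in \<open>auto simp del: eq_divide_eq_numeral1\<close>)
  then show ?thesis unfolding pathin_def loop_join_def .
qed

lemma pathin_reverse:
  assumes "pathin X p"
  shows "pathin X (\<lambda>t. p (1 - t))"
proof -
  have "continuous_map (top_of_set {0..1}) (top_of_set {0..1::real}) (\<lambda>t. 1 - t)"
    by (auto intro!: continuous_intros)
  from continuous_map_compose[OF this assms[unfolded pathin_def]] show ?thesis
    by (simp add: pathin_def o_def)
qed

context local_primitives begin

text \<open>The relation between the four sides is additive under horizontal and vertical subdivision, and
  a small rectangle is mapped into the domain of one local primitive, where it telescopes.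
  Bisection in the second coordinate shows it for narrow vertical strips; bisection in the first
  coordinate then concludes.\<close>

lemma path_integral_rectangle:
  assumes K: "continuous_map (top_of_set ({a..b} \<times> {c..d})) X K" and "a \<le> b" and "c \<le> d"
  shows "path_integral (\<lambda>s. K (s, c)) a b + path_integral (\<lambda>t. K (b, t)) c d =
    path_integral (\<lambda>t. K (a, t)) c d + path_integral (\<lambda>s. K (s, d)) a b"
proof -
  \<comment> \<open>The assertion for the subrectangle \<open>[u, v] \<times> [s, t]\<close>.\<close>
  define R where "R u v s t \<longleftrightarrow>
    path_integral (\<lambda>x. K (x, s)) u v + path_integral (\<lambda>y. K (v, y)) s t =
    path_integral (\<lambda>y. K (u, y)) s t + path_integral (\<lambda>x. K (x, t)) u v" for u v s t
  have hor: "continuous_map (top_of_set {u..v}) X (\<lambda>x. K (x, y))"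
    if "a \<le> u" "v \<le> b" "c \<le> y" "y \<le> d" for u v y
  proof -
    have "continuous_map (top_of_set {u..v}) (top_of_set ({a..b} \<times> {c..d})) (\<lambda>x. (x, y))"
      using that by (auto intro!: continuous_intros)
    from continuous_map_compose[OF this K] show ?thesis by (simp add: o_def)
  qed
  have ver: "continuous_map (top_of_set {s..t}) X (\<lambda>y. K (x, y))"
    if "c \<le> s" "t \<le> d" "a \<le> x" "x \<le> b" for s t x
  proof -
    have "continuous_map (top_of_set {s..t}) (top_of_set ({a..b} \<times> {c..d})) (\<lambda>y. (x, y))"
      using that by (auto intro!: continuous_intros)
    from continuous_map_compose[OF this K] show ?thesis by (simp add: o_def)
  qed
  have R_hor: "R u w s t" if "R u v s t" "R v w s t" "a \<le> u" "u \<le> v" "v \<le> w" "w \<le> b" "c \<le> s" "s \<le> t" "t \<le> d"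
    for u v w s t
    using that(1,2) path_integral_split[OF that(4,5) hor[of u w s]]
      path_integral_split[OF that(4,5) hor[of u w t]] that(3-)
        unfolding R_def by (simp add: algebra_simps)
  have glue: "p + (r + r') = (q + q') + p''" if "p + r = q + p'" "p' + r' = q' + p''"
    for p p' p'' q q' r r' :: complex
  proof -
    have "p = q + p' - r" "p' = q' + p'' - r'" using that by (simp_all add: eq_diff_eq)
    then show ?thesis by simp
  qed
  have R_ver: "R u v s w" if "R u v s t" "R u v t w" "a \<le> u" "u \<le> v" "v \<le> b" "c \<le> s" "s \<le> t" "t \<le> w" "w \<le> d"
    for u v w s t
    using glue[OF that(1,2)[unfolded R_def]] path_integral_split[OF that(7,8) ver[of s w u]]
      path_integral_split[OF that(7,8) ver[of s w v]] that(3-) unfolding R_def by simp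
  define E where "E x s t \<longleftrightarrow> (c \<le> s \<and> s \<le> t \<and> t \<le> d \<longrightarrow>
    (\<exists>\<delta>>0. \<forall>u v. a \<le> u \<and> u \<le> x \<and> x \<le> v \<and> v \<le> b \<and> v - u < \<delta> \<longrightarrow> R u v s t))" for x s t
  have strip: "E x c d" if x: "a \<le> x" "x \<le> b" for x
    using \<open>c \<le> d\<close>
  proof (induction rule: Bolzano)
    case (trans r s t)
    show ?case unfolding E_def
    proof
      assume *: "c \<le> r \<and> r \<le> t \<and> t \<le> d"
      with trans obtain \<delta> \<epsilon> where "\<delta> > 0" "\<epsilon> > 0"
        and \<delta>: "\<And>u v. a \<le> u \<and> u \<le> x \<and> x \<le> v \<and> v \<le> b \<and> v - u < \<delta> \<Longrightarrow> R u v r s"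
        and \<epsilon>: "\<And>u v. a \<le> u \<and> u \<le> x \<and> x \<le> v \<and> v \<le> b \<and> v - u < \<epsilon> \<Longrightarrow> R u v s t"
        unfolding E_def by (smt (verit))
      have "R u v r t" if "a \<le> u \<and> u \<le> x \<and> x \<le> v \<and> v \<le> b \<and> v - u < min \<delta> \<epsilon>" for u v
        using R_ver[OF \<delta>[of u v] \<epsilon>[of u v]] that * trans by auto
      moreover have "min \<delta> \<epsilon> > 0"
        using \<open>\<delta> > 0\<close> \<open>\<epsilon> > 0\<close> by simp
      ultimately show "\<exists>\<delta>>0. \<forall>u v. a \<le> u \<and> u \<le> x \<and> x \<le> v \<and> v \<le> b \<and> v - u < \<delta> \<longrightarrow> R u v r t" by blast
    qed
  next
    case (local y)
    then have xy: "(x, y) \<in> {a..b} \<times> {c..d}" using x by auto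
    have "K (x, y) \<in> topspace X" using K xy by (auto simp: continuous_map_def)
    then obtain U F where UF: "(U, F) \<in> Fs" "K (x, y) \<in> U" using cover by blast
    obtain e where e: "e > 0" "\<And>z. z \<in> {a..b} \<times> {c..d} \<Longrightarrow> dist z (x, y) < e \<Longrightarrow> K z \<in> U"
      using continuous_map_nearby[OF K xy open_dom[OF UF(1)] UF(2)] by blast
    have "R u v s t" if "s \<le> y" "y \<le> t" "t - s < e / 2" "c \<le> s" "t \<le> d"
      "a \<le> u" "u \<le> x" "x \<le> v" "v \<le> b" "v - u < e / 2" for u v s t
    proof -
      have U: "K (x', y') \<in> U" if "x' \<in> {u..v}" "y' \<in> {s..t}" for x' y'
      proof -
        have "dist (x', y') (x, y) \<le> dist x' x + dist y' y"
          using norm_Pair_le[of "x' - x" "y' - y"] by (simp add: dist_norm)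
        also have "\<dots> < e"
          using that \<open>s \<le> y\<close> \<open>y \<le> t\<close> \<open>t - s < e / 2\<close> \<open>u \<le> x\<close> \<open>x \<le> v\<close> \<open>v - u < e / 2\<close>
          by (auto simp: dist_real_def)
        finally show ?thesis using that \<open>c \<le> s\<close> \<open>t \<le> d\<close> \<open>a \<le> u\<close> \<open>v \<le> b\<close> by (intro e(2)) auto
      qed
      have "u \<le> v" "s \<le> t" using that by auto
      note int = path_integral_in_domain[OF _ _ UF(1)]
      show ?thesis unfolding R_def
        using int[OF \<open>u \<le> v\<close> hor[of u v s]] int[OF \<open>u \<le> v\<close> hor[of u v t]]
          int[OF \<open>s \<le> t\<close> ver[of s t u]] int[OF \<open>s \<le> t\<close> ver[of s t v]] U that by simp
    qed
    then have "\<forall>s t. s \<le> y \<and> y \<le> t \<and> t - s < e / 2 \<longrightarrow> E x s t"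
      unfolding E_def using e(1) by (meson half_gt_zero)
    then show ?case using e(1) half_gt_zero by blast
  qed
  have "a \<le> a \<and> a \<le> b \<and> b \<le> b \<longrightarrow> R a b c d"
    using \<open>a \<le> b\<close>
  proof (induction rule: Bolzano[where P = "\<lambda>u v. a \<le> u \<and> u \<le> v \<and> v \<le> b \<longrightarrow> R u v c d"])
    case (trans u v w)
    then show ?case using R_hor[of u v c d w] \<open>c \<le> d\<close> by auto
  next
    case (local x)
    then obtain \<delta> where "\<delta> > 0" "\<forall>u v. a \<le> u \<and> u \<le> x \<and> x \<le> v \<and> v \<le> b \<and> v - u < \<delta> \<longrightarrow> R u v c d"
      using strip[of x] \<open>c \<le> d\<close> unfolding E_def by auto
    then show ?case by blast
  qed
  then show ?thesis using \<open>a \<le> b\<close> unfolding R_def by simp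
qed

text \<open>Two of the four sides of the homotopy are constant at the base point.\<close>

lemma path_integral_homotopic:
  assumes "loop_homotopic X x p r" and "p \<in> loops X x"
  shows "path_integral p 0 1 = path_integral r 0 1"
proof -
  have x: "x \<in> topspace X"
    using assms(2) path_start_in_topspace by (auto simp: loops_def)
  obtain h where h: "continuous_map (prod_topology (top_of_set {0..1::real}) (top_of_set {0..1::real})) X h"
    "\<forall>t. h (0, t) = p t" "\<forall>t. h (1, t) = r t" "\<forall>s\<in>{0..1}. h (s, 0) = x \<and> h (s, 1) = x"
    using assms(1) unfolding loop_homotopic_def homotopic_with_def by blast
  have "continuous_map (top_of_set ({0..1} \<times> {0..1})) X h"
    using h(1) by simp
  from path_integral_rectangle[OF this] h(2,3)
  have "path_integral (\<lambda>s. h (s, 0)) 0 1 + path_integral r 0 1 = path_integral p 0 1 + path_integral (\<lambda>s. h (s, 1)) 0 1"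
    by simp
  moreover have "path_integral (\<lambda>s. h (s, 0)) 0 1 = path_integral (\<lambda>_. x) 0 1"
    "path_integral (\<lambda>s. h (s, 1)) 0 1 = path_integral (\<lambda>_. x) 0 1"
    by (intro path_integral_cong; simp add: h(4))+
  ultimately show ?thesis using path_integral_const[OF x, of 0 1] by simp
qed

lemma path_integral_join:
  assumes "pathin X p" and "pathin X r" and "p 1 = r 0"
  shows "path_integral (loop_join p r) 0 1 = path_integral p 0 1 + path_integral r 0 1"
proof -
  note cont = assms(1,2)[unfolded pathin_def] pathin_join[OF assms, unfolded pathin_def]
  have "path_integral (loop_join p r) 0 1 = path_integral (loop_join p r) 0 (1/2) + path_integral (loop_join p r) (1/2) 1"
    by (rule path_integral_split[OF _ _ cont(3)]) auto
  also have "path_integral (loop_join p r) 0 (1/2) = path_integral (\<lambda>t. p (2 * t)) 0 (1/2)"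
    by (rule path_integral_cong) (auto simp: loop_join_def)
  also have "\<dots> = path_integral p 0 1"
    by (rule path_integral_reparam[OF _ _ cont(1)]) (auto intro!: continuous_intros)
  also have "path_integral (loop_join p r) (1/2) 1 = path_integral (\<lambda>t. r (2 * t - 1)) (1/2) 1"
  proof (rule path_integral_cong)
    fix s :: real assume "s \<in> {1/2..1}"
    then show "loop_join p r s = r (2 * s - 1)"
      using assms(3) by (cases "s = 1/2") (auto simp: loop_join_def simp del: eq_divide_eq_numeral1)
  qed
  also have "\<dots> = path_integral r 0 1"
    by (rule path_integral_reparam[OF _ _ cont(2)]) (auto intro!: continuous_intros)
  finally show ?thesis .
qed

end

section \<open>Integration over singular chains\<close>

lemma continuous_map_standard_simplex:
  assumes "\<And>i. continuous_map T euclideanreal (\<lambda>x. e x i)"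
    and "\<And>x. x \<in> topspace T \<Longrightarrow> e x \<in> standard_simplex p"
  shows "continuous_map T (subtopology (powertop_real UNIV) (standard_simplex p)) e"
  by (rule continuous_map_into_subtopology) (use assms in \<open>auto simp: continuous_map_componentwise_UNIV\<close>)

text \<open>Barycentric coordinates with respect to the first three vertices; with \<open>w = 0\<close> this also
  parametrises the standard 1-simplex.\<close>

definition simplex_point :: "real \<Rightarrow> real \<Rightarrow> real \<Rightarrow> nat \<Rightarrow> real" where
  "simplex_point u v w = (\<lambda>i. if i = 0 then u else if i = 1 then v else if i = 2 then w else 0)"

lemma simplex_point_in_triangle:
  "0 \<le> u \<Longrightarrow> 0 \<le> v \<Longrightarrow> 0 \<le> w \<Longrightarrow> u + v + w = 1 \<Longrightarrow> simplex_point u v w \<in> standard_simplex 2"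
  by (auto simp: simplex_point_def standard_simplex_def atMost_Suc eval_nat_numeral)

lemma simplex_point_in_edge:
  "0 \<le> u \<Longrightarrow> 0 \<le> v \<Longrightarrow> u + v = 1 \<Longrightarrow> simplex_point u v 0 \<in> standard_simplex 1"
  by (auto simp: simplex_point_def standard_simplex_def atMost_Suc eval_nat_numeral)

lemma simplical_face_simplex_point:
  "simplical_face 0 (simplex_point u v 0) = simplex_point 0 u v"
  "simplical_face (Suc 0) (simplex_point u v 0) = simplex_point u 0 v"
  "simplical_face 2 (simplex_point u v 0) = simplex_point u v 0"
  by (auto simp: simplical_face_def simplex_point_def fun_eq_iff)

context local_primitives begin

definition edge_path :: "((nat \<Rightarrow> real) \<Rightarrow> 'a) \<Rightarrow> real \<Rightarrow> 'a" where
  "edge_path \<sigma> t = \<sigma> (simplex_point (1 - t) t 0)"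

definition chain_integral :: "'a chain \<Rightarrow> complex" where
  "chain_integral c = (\<Sum>\<sigma>\<in>Poly_Mapping.keys c. of_int (Poly_Mapping.lookup c \<sigma>) * path_integral (edge_path \<sigma>) 0 1)"

lemma chain_integral_superset:
  assumes "finite S" and "Poly_Mapping.keys c \<subseteq> S"
  shows "chain_integral c = (\<Sum>\<sigma>\<in>S. of_int (Poly_Mapping.lookup c \<sigma>) * path_integral (edge_path \<sigma>) 0 1)"
  unfolding chain_integral_def
  by (rule sum.mono_neutral_left) (use assms in \<open>auto simp: in_keys_iff\<close>)

lemma chain_integral_diff: "chain_integral (c - d) = chain_integral c - chain_integral d"
proof -
  let ?S = "Poly_Mapping.keys c \<union> Poly_Mapping.keys d"
  have "Poly_Mapping.keys (c - d) \<subseteq> ?S" by (rule keys_diff)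
  then show ?thesis
    by (simp add: chain_integral_superset[of ?S] lookup_minus sum_subtractf left_diff_distrib)
qed

lemma chain_integral_0 [simp]: "chain_integral 0 = 0"
  by (simp add: chain_integral_def)

lemma chain_integral_add: "chain_integral (c + d) = chain_integral c + chain_integral d"
  using chain_integral_diff[of c "0 - d"] chain_integral_diff[of 0 d] by simp

lemma chain_integral_sum: "chain_integral (\<Sum>i\<in>I. c i) = (\<Sum>i\<in>I. chain_integral (c i))"
  by (induction I rule: infinite_finite_induct) (auto simp: chain_integral_add)

lemma chain_integral_cmul: "chain_integral (frag_cmul n c) = of_int n * chain_integral c"
proof -
  have "Poly_Mapping.keys (frag_cmul n c) \<subseteq> Poly_Mapping.keys c" by (rule keys_cmul)
  then show ?thesis
    by (simp add: chain_integral_superset[of "Poly_Mapping.keys c"] frag_cmul_def sum_distrib_left mult.assoc)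
qed

lemma chain_integral_of [simp]: "chain_integral (frag_of \<sigma>) = path_integral (edge_path \<sigma>) 0 1"
  by (simp add: chain_integral_def)

text \<open>The unit square is mapped onto the triangle by collapsing the side \<open>s = 0\<close> to the vertex \<open>0\<close>:
  \<open>s\<close> is the distance from that vertex and \<open>t\<close> runs along the opposite edge. The remaining three
  sides become the three faces.\<close>

lemma chain_integral_boundary_simplex:
  assumes "singular_simplex 2 X \<sigma>"
  shows "chain_integral (chain_boundary 2 (frag_of \<sigma>)) = 0"
proof -
  define e where "e = (\<lambda>(s, t). simplex_point (1 - s) (s * (1 - t)) (s * t))"
  define K where "K = \<sigma> \<circ> e"
  have "continuous_map (top_of_set ({0..1} \<times> {0..1})) (subtopology (powertop_real UNIV) (standard_simplex 2)) e"
  proof (rule continuous_map_standard_simplex)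
    fix i show "continuous_map (top_of_set ({0..1} \<times> {0..1})) euclideanreal (\<lambda>x. e x i)"
      by (cases "i = 0"; cases "i = 1"; cases "i = 2")
         (auto simp: e_def simplex_point_def case_prod_unfold intro!: continuous_intros)
  next
    fix x :: "real \<times> real" assume "x \<in> topspace (top_of_set ({0..1} \<times> {0..1}))"
    then show "e x \<in> standard_simplex 2"
      by (auto simp: e_def algebra_simps intro!: simplex_point_in_triangle mult_left_le)
  qed
  then have K: "continuous_map (top_of_set ({0..1} \<times> {0..1})) X K"
    unfolding K_def using assms by (auto simp: singular_simplex_def intro: continuous_map_compose)
  have face: "edge_path (singular_face 2 k \<sigma>) t = \<sigma> (simplical_face k (simplex_point (1 - t) t 0))"
    if "t \<in> {0..1}" for k t
    using that simplex_point_in_edge[of "1 - t" t] by (simp add: edge_path_def singular_face_def)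
  have "path_integral (\<lambda>s. K (s, 0)) 0 1 = path_integral (edge_path (singular_face 2 2 \<sigma>)) 0 1"
    "path_integral (\<lambda>t. K (1, t)) 0 1 = path_integral (edge_path (singular_face 2 0 \<sigma>)) 0 1"
    "path_integral (\<lambda>s. K (s, 1)) 0 1 = path_integral (edge_path (singular_face 2 (Suc 0) \<sigma>)) 0 1"
    by (rule path_integral_cong; simp add: face K_def e_def simplical_face_simplex_point)+
  moreover have "path_integral (\<lambda>t. K (0, t)) 0 1 = 0"
  proof -
    have "K (0, 0) \<in> topspace X" using K by (auto simp: continuous_map_def)
    from path_integral_const[OF this, of 0 1] show ?thesis by (simp add: K_def e_def)
  qed
  ultimately have "path_integral (edge_path (singular_face 2 2 \<sigma>)) 0 1 + path_integral (edge_path (singular_face 2 0 \<sigma>)) 0 1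
      = path_integral (edge_path (singular_face 2 (Suc 0) \<sigma>)) 0 1"
    using path_integral_rectangle[OF K] by simp
  moreover have bd: "chain_boundary 2 (frag_of \<sigma>) = frag_of (singular_face 2 0 \<sigma>)
      - frag_of (singular_face 2 (Suc 0) \<sigma>) + frag_of (singular_face 2 2 \<sigma>)"
    by (simp add: chain_boundary_def numeral_2_eq_2)
  ultimately show ?thesis
    unfolding bd chain_integral_add chain_integral_diff chain_integral_of by (simp add: algebra_simps)
qed

lemma chain_integral_boundary:
  assumes "singular_chain 2 X d"
  shows "chain_integral (chain_boundary 2 d) = 0"
  using assms unfolding singular_chain_def
proof (induction rule: frag_induction)
  case (one \<sigma>) then show ?case using chain_integral_boundary_simplex by simp
qed (simp_all add: chain_boundary_diff chain_integral_diff)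

lemma chain_integral_homologous:
  assumes "homologous_rel 1 X {} c d"
  shows "chain_integral c = chain_integral d"
proof -
  obtain e where "singular_chain (Suc 1) X e" "chain_boundary (Suc 1) e = c - d"
    using assms unfolding homologous_rel_def singular_relboundary_def mod_subset_empty by blast
  then show ?thesis using chain_integral_boundary[of e] chain_integral_diff[of c d]
    by (simp add: numeral_2_eq_2)
qed

end

definition loop_chain :: "(real \<Rightarrow> 'a) \<Rightarrow> 'a chain" where
  "loop_chain p = frag_of (restrict (\<lambda>x. p (x 1)) (standard_simplex 1))"

lemma loop_class_eq: "loop_class X p = homologous_rel_set 1 X {} (loop_chain p)"
  by (simp add: loop_class_def loop_chain_def)

text \<open>Both faces of the simplex are the constant map to the base point.\<close>

lemma singular_relcycle_loop_chain:
  assumes "p \<in> loops X x"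
  shows "singular_relcycle 1 X {} (loop_chain p)"
proof -
  let ?\<sigma> = "restrict (\<lambda>x. p (x 1)) (standard_simplex 1)"
  have p: "continuous_map (top_of_set {0..1}) X p" "p 0 = p 1"
    using assms by (auto simp: loops_def pathin_def)
  have "continuous_map (subtopology (powertop_real UNIV) (standard_simplex 1)) (top_of_set {0..1}) (\<lambda>x. x 1)"
  proof (rule continuous_map_into_subtopology)
    show "(\<lambda>x. x 1) \<in> topspace (subtopology (powertop_real UNIV) (standard_simplex 1)) \<rightarrow> {0..1}"
      unfolding topspace_standard_simplex by (auto simp: standard_simplex_def simp del: One_nat_def)
  qed (auto intro!: continuous_map_from_subtopology continuous_map_product_projection)
  from continuous_map_compose[OF this p(1)]
  have "singular_simplex 1 X ?\<sigma>"
    unfolding singular_simplex_def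
    by (auto simp: topspace_standard_simplex elim!: continuous_map_eq)
  moreover have "singular_face 1 0 ?\<sigma> = singular_face 1 1 ?\<sigma>"
  proof (rule ext)
    fix y
    show "singular_face 1 0 ?\<sigma> y = singular_face 1 1 ?\<sigma> y"
    proof (cases "y \<in> standard_simplex 0")
      case True
      then have "simplical_face 0 y \<in> standard_simplex 1" "simplical_face 1 y \<in> standard_simplex 1"
        by (auto intro!: simplical_face_in_standard_simplex)
      moreover have "y 0 = 1" using True by (auto simp: standard_simplex_def)
      ultimately show ?thesis using True p(2) by (simp add: singular_face_def simplical_face_def)
    qed (simp add: singular_face_def)
  qed
  ultimately show ?thesis
    by (simp add: singular_cycle loop_chain_def singular_chain_of chain_boundary_of)
qed

lemma homology_class_mult:
  assumes "singular_relcycle 1 X {} c" and "singular_relcycle 1 X {} d"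
  shows "homologous_rel_set 1 X {} c \<otimes>\<^bsub>homology_group 1 X\<^esub> homologous_rel_set 1 X {} d =
    homologous_rel_set 1 X {} (c + d)"
  using normal.r_coset_hom_Mod[OF normal_subgroup_singular_relboundary_relcycle[of 1 X "{}"]] assms
    nontrivial_relative_homology_group[of 1 X "{}"]
  unfolding hom_def by (simp add: right_coset_singular_relboundary)

text \<open>Passing to homology classes is a homomorphism on the group of cycles, which is a subgroup
  of a free abelian group.\<close>

lemma homology_class_pow:
  fixes n :: int
  assumes "singular_relcycle 1 X {} c"
  shows "homologous_rel_set 1 X {} c [^]\<^bsub>homology_group 1 X\<^esub> n = homologous_rel_set 1 X {} (frag_cmul n c)"
proof -
  have "homologous_rel_set 1 X {} \<in> hom (relcycle_group 1 X {}) (homology_group 1 X)"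
    using normal.r_coset_hom_Mod[OF normal_subgroup_singular_relboundary_relcycle[of 1 X "{}"]]
      nontrivial_relative_homology_group[of 1 X "{}"] by (simp add: right_coset_singular_relboundary)
  then have "homologous_rel_set 1 X {} (c [^]\<^bsub>relcycle_group 1 X {}\<^esub> n) =
      homologous_rel_set 1 X {} c [^]\<^bsub>homology_group 1 X\<^esub> n"
    by (rule hom_int_pow) (use assms in auto)
  moreover have "c [^]\<^bsub>relcycle_group 1 X {}\<^esub> n = frag_cmul n c"
  proof -
    have "c [^]\<^bsub>relcycle_group 1 X {}\<^esub> n = c [^]\<^bsub>chain_group 1 X\<^esub> n"
      unfolding relcycle_group_def
      by (rule group.int_pow_subgroup_generated) (use assms carrier_relcycle_group[of 1 X "{}"] in \<open>auto simp: relcycle_group_def\<close>)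
    also have "\<dots> = frag_cmul n c"
      using assms unfolding chain_group_def
      by (intro int_pow_free_Abelian_group) (auto simp: singular_cycle singular_chain_def)
    finally show ?thesis .
  qed
  ultimately show ?thesis by simp
qed

lemma homology_class_finprod:
  fixes m :: "'i \<Rightarrow> int"
  assumes "finite I" and "\<And>i. i \<in> I \<Longrightarrow> singular_relcycle 1 X {} (c i)"
  shows "finprod (homology_group 1 X) (\<lambda>i. homologous_rel_set 1 X {} (c i) [^]\<^bsub>homology_group 1 X\<^esub> m i) I =
      homologous_rel_set 1 X {} (\<Sum>i\<in>I. frag_cmul (m i) (c i))
    \<and> singular_relcycle 1 X {} (\<Sum>i\<in>I. frag_cmul (m i) (c i))"
  using assms
proof (induction I rule: finite_induct)
  case empty
  interpret comm_group "homology_group 1 X" by simp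
  show ?case
    using one_relative_homology_group[of 1 X "{}"] homologous_rel_eq_relboundary[of 1 X "{}" 0]
    by (simp add: singular_relcycle_0 singular_relboundary_0)
next
  case (insert i I)
  interpret comm_group "homology_group 1 X" by simp
  have cyc: "singular_relcycle 1 X {} (frag_cmul (m j) (c j))" if "j \<in> insert i I" for j
    using insert.prems[OF that] by (simp add: singular_cycle singular_chain_cmul chain_boundary_cmul)
  have mem: "homologous_rel_set 1 X {} (c j) [^]\<^bsub>homology_group 1 X\<^esub> m j \<in> carrier (homology_group 1 X)"
    if "j \<in> insert i I" for j
    using carrier_relative_homology_group[of 1 X "{}"] insert.prems[OF that]
      by (intro int_pow_closed) auto
  show ?case
    using insert mem cyc[of i] homology_class_mult[OF cyc[of i], of "\<Sum>j\<in>I. frag_cmul (m j) (c j)"]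
    by (subst finprod_insert)
       (simp_all add: homology_class_pow singular_relcycle_add Pi_iff del: One_nat_def)
qed

context local_primitives begin

lemma chain_integral_loop_chain: "chain_integral (loop_chain p) = path_integral p 0 1"
proof -
  have "path_integral (edge_path (restrict (\<lambda>x. p (x 1)) (standard_simplex 1))) 0 1 = path_integral p 0 1"
  proof (rule path_integral_cong)
    fix t :: real assume "t \<in> {0..1}"
    then have "simplex_point (1 - t) t 0 \<in> standard_simplex 1" by (intro simplex_point_in_edge) auto
    then show "edge_path (restrict (\<lambda>x. p (x 1)) (standard_simplex 1)) t = p t"
      by (simp add: edge_path_def) (simp add: simplex_point_def)
  qed
  then show ?thesis by (simp add: loop_chain_def)
qed

text \<open>Integration over chains turns a relation between homology classes of loops into the corresponding
  linear relation between the integrals.\<close>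

lemma path_integral_induced:
  fixes m :: "'i \<Rightarrow> int"
  assumes "continuous_map X X f" and "p \<in> loops X x" and "finite I"
    and "\<And>i. i \<in> I \<Longrightarrow> c i \<in> loops X x"
    and "hom_induced 1 X {} X {} f (loop_class X p) =
      finprod (homology_group 1 X) (\<lambda>i. loop_class X (c i) [^]\<^bsub>homology_group 1 X\<^esub> m i) I"
  shows "path_integral (f \<circ> p) 0 1 = (\<Sum>i\<in>I. of_int (m i) * path_integral (c i) 0 1)"
proof -
  have "hom_induced 1 X {} X {} f (loop_class X p) = homologous_rel_set 1 X {} (chain_map 1 f (loop_chain p))"
    using hom_induced_chain_map[of X X f "{}" "{}" 1 "loop_chain p"] assms(1)
      singular_relcycle_loop_chain[OF assms(2)] by (simp add: loop_class_eq)
  also have "chain_map 1 f (loop_chain p) = loop_chain (f \<circ> p)"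
    unfolding loop_chain_def chain_map_of simplex_map_def
    by (rule arg_cong[of _ _ frag_of]) (auto simp: restrict_def)
  finally have "homologous_rel_set 1 X {} (loop_chain (f \<circ> p)) =
      homologous_rel_set 1 X {} (\<Sum>i\<in>I. frag_cmul (m i) (loop_chain (c i)))"
    using homology_class_finprod[OF assms(3) singular_relcycle_loop_chain[OF assms(4)]] assms(5)
    by (simp add: loop_class_eq)
  then have "homologous_rel 1 X {} (loop_chain (f \<circ> p)) (\<Sum>i\<in>I. frag_cmul (m i) (loop_chain (c i)))"
    by (simp only: homologous_rel_set_eq)
  from chain_integral_homologous[OF this] show ?thesis
    by (simp add: chain_integral_loop_chain chain_integral_sum chain_integral_cmul)
qed

end

section \<open>Integrals over the fundamental group\<close>

lemma homotopy_class_loops: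
  assumes "r \<in> homotopy_class X x p"
  shows "p \<in> loops X x" and "r \<in> loops X x"
proof -
  have h: "homotopic_with (\<lambda>r. r 0 = x \<and> r 1 = x) (top_of_set {0..1}) X p r"
    using assms by (simp add: homotopy_class_def loop_homotopic_def)
  show "p \<in> loops X x" "r \<in> loops X x"
    using homotopic_with_imp_continuous_maps[OF h] homotopic_with_imp_property[OF h]
    by (simp_all add: loops_def pathin_def)
qed

lemma loop_in_homotopy_class: "p \<in> loops X x \<Longrightarrow> p \<in> homotopy_class X x p"
  unfolding homotopy_class_def loop_homotopic_def loops_def pathin_def by simp

context local_primitives begin

text \<open>If \<open>loop_join p r\<close> is continuous, then \<open>p\<close> is a path, and its end point is the limit at
  \<open>t = 1/2\<close> from the right, which is the starting point of \<open>r\<close> since limits are unique.\<close>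

lemma loop_of_loop_join:
  assumes "Hausdorff_space X" and "loop_join p r \<in> loops X x" and "r \<in> loops X x"
  shows "p \<in> loops X x"
proof -
  have j: "continuous_map (top_of_set {0..1}) X (loop_join p r)" "loop_join p r 0 = x"
    and r: "continuous_map (top_of_set {0..1}) X r" "r 0 = x"
    using assms(2,3) by (auto simp: loops_def pathin_def)
  have "continuous_map (top_of_set {0..1}) (top_of_set {0..1::real}) (\<lambda>t. t / 2)"
    by (auto intro!: continuous_intros)
  from continuous_map_compose[OF this j(1)] have "continuous_map (top_of_set {0..1}) X p"
    by (rule continuous_map_eq) (auto simp: loop_join_def)
  moreover have "p 1 = x"
  proof -
    have "continuous_map (top_of_set {0..1}) (top_of_set {0..1::real}) (\<lambda>t. (t + 1) / 2)"
      by (auto intro!: continuous_intros)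
    from continuous_map_compose[OF this j(1)]
    have c: "continuous_map (top_of_set {0..1}) X (\<lambda>t. loop_join p r ((t + 1) / 2))"
      by (simp add: o_def)
    have cl: "0 \<in> top_of_set {0..1} closure_of {0<..1::real}"
    proof -
      have "{0..1} \<inter> {0<..1} = {0<..1::real}" by auto
      then show ?thesis by (simp add: closure_of_subtopology closure_greaterThanAtMost)
    qed
    have "loop_join p r ((0 + 1) / 2) = r 0"
      by (rule forall_in_closure_of_eq[OF cl assms(1) c r(1)]) (simp add: loop_join_def field_simps)
    then show ?thesis using r(2) by (simp add: loop_join_def)
  qed
  ultimately show ?thesis using j(2) by (simp add: loops_def pathin_def loop_join_def)
qed

lemma path_integral_loop_join:
  assumes "p \<in> loops X x" and "r \<in> loops X x"
  shows "loop_join p r \<in> loops X x"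
    and "path_integral (loop_join p r) 0 1 = path_integral p 0 1 + path_integral r 0 1"
  using assms path_integral_join[of p r] pathin_join[of X p r]
    by (auto simp: loops_def) (auto simp: loop_join_def)

text \<open>Every loop is homotopic to a product of generators and of formal inverses, and integration
  is additive under concatenation. For a formal inverse the presentation provides the relation that
  the generator times its inverse is trivial, which determines the integrals over its members
  that are loops. Members that are not loops cannot contribute, by \<open>loop_of_loop_join\<close>.\<close>

lemma path_integral_in_subgroup:
  assumes haus: "Hausdorff_space X" and x: "x \<in> topspace X"
    and pres: "has_presentation (fundamental_group X x) I (\<lambda>i. homotopy_class X x (c i)) R"
    and c: "\<And>i. i \<in> I \<Longrightarrow> c i \<in> loops X x"
    and S0: "0 \<in> S" and S_diff: "\<And>u v. u \<in> S \<Longrightarrow> v \<in> S \<Longrightarrow> u - v \<in> S"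
    and gen: "\<And>i. i \<in> I \<Longrightarrow> path_integral (c i) 0 1 \<in> S"
    and p: "p \<in> loops X x"
  shows "path_integral p 0 1 \<in> S"
proof -
  let ?G = "fundamental_group X x"
  let ?c = "\<lambda>i. homotopy_class X x (c i)"
  have S_add: "u + v \<in> S" if "u \<in> S" "v \<in> S" for u v
    using S_diff[OF that(1) S_diff[OF S0 that(2)]] by simp
  define good where "good C \<longleftrightarrow> (\<forall>r \<in> C \<inter> loops X x. path_integral r 0 1 \<in> S)" for C
  have hom: "path_integral r 0 1 = path_integral p 0 1" if "r \<in> homotopy_class X x p" for p r
    using path_integral_homotopic[of x p r] homotopy_class_loops[OF that] that
      by (simp add: homotopy_class_def)
  have mult: "C \<otimes>\<^bsub>?G\<^esub> D = (\<Union>p\<in>C. \<Union>q\<in>D. homotopy_class X x (loop_join p q))" for C D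
    by (simp add: fundamental_group_def)
  have const: "(\<lambda>_. x) \<in> loops X x" using x by (simp add: loops_def)
  have one: "\<one>\<^bsub>?G\<^esub> = homotopy_class X x (\<lambda>_. x)"
    by (simp add: fundamental_group_def)
  have one_0: "path_integral r 0 1 = 0" if "r \<in> \<one>\<^bsub>?G\<^esub>" for r
    using hom[OF that[unfolded one]] path_integral_const[OF x, of 0 1] by simp
  have good_c: "good (?c i)" if "i \<in> I" for i
    using hom gen[OF that] by (auto simp: good_def)
  have good_mult: "C \<otimes>\<^bsub>?G\<^esub> D \<subseteq> loops X x \<and> good (C \<otimes>\<^bsub>?G\<^esub> D)" if "good C" "good D" "D \<subseteq> loops X x" for C D
  proof -
    have "r \<in> loops X x \<and> path_integral r 0 1 \<in> S"
      if "p \<in> C" "q \<in> D" "r \<in> homotopy_class X x (loop_join p q)" for p q r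
    proof -
      have q: "q \<in> loops X x" using that(2) \<open>D \<subseteq> loops X x\<close> by blast
      then have p: "p \<in> loops X x"
        using loop_of_loop_join[OF haus] homotopy_class_loops(1)[OF that(3)] by blast
      have "path_integral r 0 1 = path_integral p 0 1 + path_integral q 0 1"
        using hom[OF that(3)] path_integral_loop_join(2)[OF p q] by simp
      then show ?thesis
        using p q that \<open>good C\<close> \<open>good D\<close> S_add homotopy_class_loops(2)[OF that(3)] by (auto simp: good_def)
    qed
    then show ?thesis unfolding mult good_def by blast
  qed
  have good_inv: "good (inv\<^bsub>?G\<^esub> (?c i))" if i: "i \<in> I" for i
    unfolding good_def
  proof
    fix y assume "y \<in> inv\<^bsub>?G\<^esub> (?c i) \<inter> loops X x"
    then have y: "y \<in> inv\<^bsub>?G\<^esub> (?c i)" "y \<in> loops X x" by auto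
    have "word_equiv R [(i, True), (i, False)] []"
      using word_equiv.cancel[of R "[]" i True "[]"] by simp
    moreover have "\<forall>w. fst ` set w \<subseteq> I \<longrightarrow> (word_value ?G ?c w = \<one>\<^bsub>?G\<^esub> \<longleftrightarrow> word_equiv R w [])"
      using pres by (simp add: has_presentation_def)
    then have "word_value ?G ?c [(i, True), (i, False)] = \<one>\<^bsub>?G\<^esub> \<longleftrightarrow> word_equiv R [(i, True), (i, False)] []"
      by (rule allE[of _ "[(i, True), (i, False)]"]) (use i in simp)
    ultimately have *: "?c i \<otimes>\<^bsub>?G\<^esub> (inv\<^bsub>?G\<^esub> (?c i) \<otimes>\<^bsub>?G\<^esub> \<one>\<^bsub>?G\<^esub>) = \<one>\<^bsub>?G\<^esub>"
      by (simp add: word_value_def)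
    \<comment> \<open>A word is evaluated with a trailing unit, so \<open>y\<close> appears joined with the constant loop.\<close>
    let ?z = "loop_join y (\<lambda>_. x)"
    note z = path_integral_loop_join[OF y(2) const]
    note cz = path_integral_loop_join[OF c[OF i] z(1)]
    have "?z \<in> inv\<^bsub>?G\<^esub> (?c i) \<otimes>\<^bsub>?G\<^esub> \<one>\<^bsub>?G\<^esub>"
      unfolding mult one using y(1) loop_in_homotopy_class[OF const] loop_in_homotopy_class[OF z(1)]
        by blast
    then have "loop_join (c i) ?z \<in> ?c i \<otimes>\<^bsub>?G\<^esub> (inv\<^bsub>?G\<^esub> (?c i) \<otimes>\<^bsub>?G\<^esub> \<one>\<^bsub>?G\<^esub>)"
      unfolding mult[of "?c i"]
        using loop_in_homotopy_class[OF c[OF i]] loop_in_homotopy_class[OF cz(1)] by blast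
    then have "path_integral (loop_join (c i) ?z) 0 1 = 0" unfolding * by (rule one_0)
    then have "path_integral y 0 1 = 0 - path_integral (c i) 0 1"
      using z(2) cz(2) path_integral_const[OF x, of 0 1] by (simp add: eq_neg_iff_add_eq_0 add.commute)
    then show "path_integral y 0 1 \<in> S" using S_diff[OF S0 gen[OF i]] by simp
  qed
  have words: "word_value ?G ?c w \<subseteq> loops X x \<and> good (word_value ?G ?c w)"
    if "fst ` set w \<subseteq> I" for w
    using that
  proof (induction w)
    case Nil
    have "word_value ?G ?c [] = \<one>\<^bsub>?G\<^esub>" by (simp add: word_value_def)
    moreover have "\<one>\<^bsub>?G\<^esub> \<subseteq> loops X x"
      unfolding one by (rule subsetI) (erule homotopy_class_loops(2))
    ultimately show ?case using one_0 S0 by (simp add: good_def)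
  next
    case (Cons a w)
    obtain i s where a: "a = (i, s)" by (cases a)
    have "word_value ?G ?c (a # w) = (if s then ?c i else inv\<^bsub>?G\<^esub> (?c i)) \<otimes>\<^bsub>?G\<^esub> word_value ?G ?c w"
      by (simp add: word_value_def a)
    moreover have "i \<in> I" "word_value ?G ?c w \<subseteq> loops X x" "good (word_value ?G ?c w)"
      using Cons a by auto
    ultimately show ?case using good_mult[OF good_c] good_mult[OF good_inv] by (cases s) simp_all
  qed
  have "\<forall>C \<in> carrier ?G. \<exists>w. fst ` set w \<subseteq> I \<and> word_value ?G ?c w = C"
    using pres by (simp add: has_presentation_def)
  moreover have "homotopy_class X x p \<in> carrier ?G" using p by (simp add: fundamental_group_def)
  ultimately have "\<exists>w. fst ` set w \<subseteq> I \<and> word_value ?G ?c w = homotopy_class X x p" by (rule bspec)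
  then obtain w where "fst ` set w \<subseteq> I" "word_value ?G ?c w = homotopy_class X x p"
    by (elim exE conjE)
  moreover from this have "good (homotopy_class X x p)" using words[of w] by simp
  ultimately show ?thesis using loop_in_homotopy_class[OF p] p by (simp add: good_def)
qed

end

section \<open>Charts and the zeros of the quadratic differential\<close>

lemma complex_chartD:
  assumes "complex_chart X (U, \<phi>)"
  shows chart_openin: "openin X U" and chart_inj: "inj_on \<phi> U" and chart_open: "open (\<phi> ` U)"
    and chart_continuous: "continuous_map (subtopology X U) euclidean \<phi>"
proof -
  have U: "openin X U" "open (\<phi> ` U)" "homeomorphic_map (subtopology X U) (top_of_set (\<phi> ` U)) \<phi>"
    using assms by (auto simp: complex_chart_def)
  then show "openin X U" "open (\<phi> ` U)" by auto
  have "topspace (subtopology X U) = U" using openin_subset[OF U(1)] by auto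
  then show "inj_on \<phi> U" using homeomorphic_imp_injective_map[OF U(3)] by simp
  show "continuous_map (subtopology X U) euclidean \<phi>"
    using homeomorphic_imp_continuous_map[OF U(3)] continuous_map_in_subtopology by blast
qed

lemma chart_open_image:
  assumes "complex_chart X (U, \<phi>)" and "openin X W" and "W \<subseteq> U"
  shows "open (\<phi> ` W)"
proof -
  have "open_map (subtopology X U) (top_of_set (\<phi> ` U)) \<phi>"
    using assms(1) homeomorphic_imp_open_map by (auto simp: complex_chart_def)
  moreover have "openin (subtopology X U) W" 
    using assms(2,3) chart_openin[OF assms(1)] by (simp add: openin_open_subtopology)
  ultimately have "openin (top_of_set (\<phi> ` U)) (\<phi> ` W)" by (auto simp: open_map_def)
  then show ?thesis using chart_open[OF assms(1)] openin_open_eq by blast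
qed

lemma chart_open_preimage:
  assumes "complex_chart X (U, \<phi>)" and "open B"
  shows "openin X {P \<in> U. \<phi> P \<in> B}"
proof -
  have "openin (subtopology X U) {P \<in> topspace (subtopology X U). \<phi> P \<in> B}"
    using openin_continuous_map_preimage[OF chart_continuous[OF assms(1)]] assms(2) by simp
  moreover have "{P \<in> topspace (subtopology X U). \<phi> P \<in> B} = {P \<in> U. \<phi> P \<in> B}"
    using openin_subset[OF chart_openin[OF assms(1)]] by auto
  ultimately show ?thesis using chart_openin[OF assms(1)] openin_open_subtopology[of X U] by simp
qed

lemma chart_inverse_continuous:
  assumes "complex_chart X (U, \<phi>)"
  shows "continuous_map (top_of_set (\<phi> ` U)) X (inv_into U \<phi>)"
  unfolding continuous_map_def
proof (intro conjI allI impI)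
  have UX: "U \<subseteq> topspace X" using openin_subset[OF chart_openin[OF assms]] .
  show "inv_into U \<phi> \<in> topspace (top_of_set (\<phi> ` U)) \<rightarrow> topspace X"
    using UX inv_into_into[of _ \<phi> U] by (auto simp del: inv_into_f_f)
  fix W assume W: "openin X W"
  have "x \<in> \<phi> ` U \<and> inv_into U \<phi> x \<in> W \<longleftrightarrow> x \<in> \<phi> ` (U \<inter> W)" for x
  proof
    assume x: "x \<in> \<phi> ` U \<and> inv_into U \<phi> x \<in> W"
    then have eq: "\<phi> (inv_into U \<phi> x) = x" and U: "inv_into U \<phi> x \<in> U"
      by (simp_all add: f_inv_into_f inv_into_into)
    show "x \<in> \<phi> ` (U \<inter> W)"
      using imageI[of "inv_into U \<phi> x" "U \<inter> W" \<phi>] x U eq by simp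
  next
    assume "x \<in> \<phi> ` (U \<inter> W)"
    then obtain y where "x = \<phi> y" "y \<in> U" "y \<in> W" by blast
    then show "x \<in> \<phi> ` U \<and> inv_into U \<phi> x \<in> W" using chart_inj[OF assms] by simp
  qed
  then have "{x \<in> topspace (top_of_set (\<phi> ` U)). inv_into U \<phi> x \<in> W} = \<phi> ` (U \<inter> W)" by auto
  then show "openin (top_of_set (\<phi> ` U)) {x \<in> topspace (top_of_set (\<phi> ` U)). inv_into U \<phi> x \<in> W}"
    using chart_open_image[OF assms, of "U \<inter> W"] W chart_openin[OF assms] chart_open[OF assms]
    by (auto simp: openin_open_eq)
qed

locale flat_surface =
  fixes X :: "'a topology" and \<A> :: "'a chart set"
    and q :: "'a chart \<Rightarrow> complex \<Rightarrow> complex" and \<mu> :: "'a chart set"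
  assumes surface: "translation_surface X \<A> q \<mu>"
begin

abbreviation Z :: "'a set" where "Z \<equiv> differential_zeros \<A> q"

lemma surface_parts:
  "compact_riemann_surface X \<A>" "holomorphic_quadratic_differential \<A> q" "translation_structure X \<A> q \<mu>"
  using surface by (simp_all add: translation_surface_def)

lemma connected_surface: "connected_space X" and compact_surface: "compact_space X"
  and Hausdorff_surface: "Hausdorff_space X" and surface_nonempty: "topspace X \<noteq> {}"
  using surface_parts(1) by (simp_all add: compact_riemann_surface_def)

lemma atlas_chart: "(U, \<phi>) \<in> \<A> \<Longrightarrow> complex_chart X (U, \<phi>)"
  using surface_parts(1) unfolding compact_riemann_surface_def by (elim conjE) (rule bspec)

lemma atlas_cover: 
  assumes "P \<in> topspace X"
  shows "\<exists>U \<phi>. (U, \<phi>) \<in> \<A> \<and> P \<in> U"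
proof -
  have "P \<in> \<Union> (fst ` \<A>)"
    using surface_parts(1) assms by (simp add: compact_riemann_surface_def)
  then show ?thesis by force
qed

lemma q_holomorphic:
  assumes "(U, \<phi>) \<in> \<A>"
  shows "q (U, \<phi>) holomorphic_on \<phi> ` U"
proof -
  have "\<forall>(U, \<phi>)\<in>\<A>. q (U, \<phi>) holomorphic_on \<phi> ` U"
    using surface_parts(2) unfolding holomorphic_quadratic_differential_def by (rule conjunct1)
  from bspec[OF this assms] show ?thesis by simp
qed

lemma zero_iff:
  assumes "(U, \<phi>) \<in> \<A>" and "P \<in> U"
  shows "P \<in> Z \<longleftrightarrow> q (U, \<phi>) (\<phi> P) = 0"
proof
  assume "P \<in> Z"
  then obtain V \<psi> where V: "(V, \<psi>) \<in> \<A>" "P \<in> V" "q (V, \<psi>) (\<psi> P) = 0"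
    by (auto simp: differential_zeros_def)
  have "\<forall>(U, \<phi>)\<in>\<A>. \<forall>(V, \<psi>)\<in>\<A>. \<forall>P \<in> U \<inter> V. q (U, \<phi>) (\<phi> P) =
      q (V, \<psi>) (\<psi> P) * (deriv (transition (U, \<phi>) (V, \<psi>)) (\<phi> P))\<^sup>2"
    using surface_parts(2) unfolding holomorphic_quadratic_differential_def by (rule conjunct2)
  from bspec[OF bspec[OF this assms(1), unfolded prod.case] V(1)] have "q (U, \<phi>) (\<phi> P) =
      q (V, \<psi>) (\<psi> P) * (deriv (transition (U, \<phi>) (V, \<psi>)) (\<phi> P))\<^sup>2"
    using assms(2) V(2) by simp
  then show "q (U, \<phi>) (\<phi> P) = 0" using V(3) by simp
qed (use assms in \<open>auto simp: differential_zeros_def\<close>)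

lemma nonzero_point: "\<exists>P \<in> topspace X. P \<notin> Z"
proof -
  obtain U \<phi> z where U: "(U, \<phi>) \<in> \<A>" "z \<in> \<phi> ` U" "q (U, \<phi>) z \<noteq> 0"
    using surface unfolding translation_surface_def by blast
  then obtain P where "P \<in> U" "z = \<phi> P" by auto
  then show ?thesis using U zero_iff[OF U(1)] openin_subset[OF chart_openin[OF atlas_chart[OF U(1)]]]
    by auto
qed

lemma open_minus_finite_nonempty:
  assumes N: "openin X N" "N \<noteq> {}" and "finite K"
  obtains Q where "Q \<in> N" and "Q \<notin> K"
proof -
  obtain P where P: "P \<in> N" using N by auto
  then obtain U \<phi> where U: "(U, \<phi>) \<in> \<A>" "P \<in> U"
    using atlas_cover openin_subset[OF N(1)] by blast
  have "open (\<phi> ` (N \<inter> U))"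
    by (rule chart_open_image[OF atlas_chart[OF U(1)]]) (use N chart_openin[OF atlas_chart[OF U(1)]] in auto)
  then have "infinite (\<phi> ` (N \<inter> U))" using P U finite_imp_not_open by blast
  then have "infinite N" by (meson finite_Int finite_imageI)
  then show thesis using that \<open>finite K\<close> by (meson finite_subset subsetI)
qed

definition disc :: "'a set \<Rightarrow> ('a \<Rightarrow> complex) \<Rightarrow> 'a \<Rightarrow> real \<Rightarrow> 'a set" where
  "disc U \<phi> P r = {Q \<in> U. \<phi> Q \<in> ball (\<phi> P) r}"

definition disc_at :: "'a \<Rightarrow> 'a set \<Rightarrow> ('a \<Rightarrow> complex) \<Rightarrow> real \<Rightarrow> bool" where
  "disc_at P U \<phi> r \<longleftrightarrow> (U, \<phi>) \<in> \<A> \<and> P \<in> U \<and> r > 0 \<and> ball (\<phi> P) r \<subseteq> \<phi> ` U \<and>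
     (\<forall>z \<in> ball (\<phi> P) r - {\<phi> P}. q (U, \<phi>) z \<noteq> 0)"

lemma openin_disc: "disc_at P U \<phi> r \<Longrightarrow> openin X (disc U \<phi> P r)"
  using chart_open_preimage[OF atlas_chart, of U \<phi> "ball (\<phi> P) r"]
    by (simp add: disc_at_def disc_def)

lemma centre_in_disc: "disc_at P U \<phi> r \<Longrightarrow> P \<in> disc U \<phi> P r"
  by (simp add: disc_at_def disc_def)

lemma disc_no_zero: "disc_at P U \<phi> r \<Longrightarrow> Q \<in> disc U \<phi> P r \<Longrightarrow> Q \<noteq> P \<Longrightarrow> Q \<notin> Z"
proof -
  assume d: "disc_at P U \<phi> r" and Q: "Q \<in> disc U \<phi> P r" "Q \<noteq> P"
  have "\<phi> Q \<noteq> \<phi> P"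
    using chart_inj[OF atlas_chart, of U \<phi>] d Q by (auto simp: disc_at_def disc_def inj_on_def)
  then show ?thesis using d Q zero_iff[of U \<phi> Q] by (auto simp: disc_at_def disc_def)
qed

lemma chart_ball_in:
  assumes U: "(U, \<phi>) \<in> \<A>" "P \<in> U" and N: "openin X N" "P \<in> N"
  obtains r where "r > 0" and "ball (\<phi> P) r \<subseteq> \<phi> ` (U \<inter> N)"
proof -
  have "open (\<phi> ` (U \<inter> N))"
    by (rule chart_open_image[OF atlas_chart[OF U(1)]]) (use N chart_openin[OF atlas_chart[OF U(1)]] in auto)
  then show thesis by (rule openE[of _ "\<phi> P"]) (use U N that in auto)
qed

text \<open>This is the identity theorem in one coordinate disc: either \<open>q\<close> vanishes near the centre or its
  zeros are isolated there.\<close>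

lemma disc_or_flat:
  assumes P: "P \<in> topspace X" and N: "openin X N" "P \<in> N"
  shows "(\<exists>N'. openin X N' \<and> P \<in> N' \<and> N' \<subseteq> Z) \<or> (\<exists>U \<phi> r. disc_at P U \<phi> r \<and> disc U \<phi> P r \<subseteq> N)"
proof -
  obtain U \<phi> where U: "(U, \<phi>) \<in> \<A>" "P \<in> U" using atlas_cover[OF P] by blast
  note ch = atlas_chart[OF U(1)]
  obtain r where r: "r > 0" "ball (\<phi> P) r \<subseteq> \<phi> ` (U \<inter> N)"
    using chart_ball_in[OF U N] .
  have sub: "disc U \<phi> P s \<subseteq> N" if "s \<le> r" for s
  proof
    fix Q assume "Q \<in> disc U \<phi> P s"
    then have "Q \<in> U" "\<phi> Q \<in> \<phi> ` (U \<inter> N)"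
      using that r(2) by (auto simp: disc_def)
    then show "Q \<in> N" using chart_inj[OF ch] by (auto simp: inj_on_def)
  qed
  have hol: "q (U, \<phi>) holomorphic_on ball (\<phi> P) r"
    using q_holomorphic[OF U(1)] r(2) by (meson holomorphic_on_subset image_mono inf_le1 order_trans)
  show ?thesis
  proof (cases "\<forall>z\<in>ball (\<phi> P) r. q (U, \<phi>) z = 0")
    case True
    have "openin X (disc U \<phi> P r)"
      using chart_open_preimage[OF ch, of "ball (\<phi> P) r"] by (simp add: disc_def)
    moreover have "disc U \<phi> P r \<subseteq> Z"
      using True zero_iff[OF U(1)] by (auto simp: disc_def)
    moreover have "P \<in> disc U \<phi> P r" using U r by (simp add: disc_def)
    ultimately show ?thesis by blast
  next
    case False
    then obtain \<beta> where \<beta>: "\<beta> \<in> ball (\<phi> P) r" "q (U, \<phi>) \<beta> \<noteq> 0" by blast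
    obtain s where s: "s > 0" "ball (\<phi> P) s \<subseteq> ball (\<phi> P) r" "\<And>z. z \<in> ball (\<phi> P) s - {\<phi> P} \<Longrightarrow> q (U, \<phi>) z \<noteq> 0"
    proof (cases "q (U, \<phi>) (\<phi> P) = 0")
      case True
      show thesis
        by (rule isolated_zeros[OF hol open_ball connected_ball _ True \<beta>]) (use r that in auto)
    next
      case False
      have "continuous_on (ball (\<phi> P) r) (q (U, \<phi>))"
        using hol by (rule holomorphic_on_imp_continuous_on)
      then have "open (ball (\<phi> P) r \<inter> q (U, \<phi>) -` (- {0}))"
        by (rule continuous_open_preimage) auto
      moreover have "ball (\<phi> P) r \<inter> q (U, \<phi>) -` (- {0}) = {z \<in> ball (\<phi> P) r. q (U, \<phi>) z \<in> - {0}}" by blast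
      ultimately have "open {z \<in> ball (\<phi> P) r. q (U, \<phi>) z \<in> - {0}}" by simp
      moreover have "\<phi> P \<in> {z \<in> ball (\<phi> P) r. q (U, \<phi>) z \<in> - {0}}"
        using False r by simp
      ultimately obtain s where "s > 0" "ball (\<phi> P) s \<subseteq> {z \<in> ball (\<phi> P) r. q (U, \<phi>) z \<in> - {0}}"
        by (meson open_contains_ball)
      then show thesis by (intro that[of s]) blast+
    qed
    have "disc_at P U \<phi> (min r s)" using U r s by (auto simp: disc_at_def)
    then show ?thesis using sub[of "min r s"] by auto
  qed
qed

text \<open>The points near which \<open>q\<close> vanishes form an open set, which is also closed, since a coordinate
  disc of the other kind in \<open>disc_or_flat\<close> contains no such point. The surface being connected and \<open>q\<close>
  not being identically zero, there are none.\<close>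

lemma no_flat_point: "\<not> (openin X N \<and> P \<in> N \<and> N \<subseteq> Z)"
proof -
  define S where "S = {P \<in> topspace X. \<exists>N. openin X N \<and> P \<in> N \<and> N \<subseteq> Z}"
  have "openin X S"
    by (subst openin_subopen) (use openin_subset S_def in blast)
  moreover have "closedin X S"
    unfolding closedin_def
  proof
    show "openin X (topspace X - S)"
    proof (subst openin_subopen, intro ballI)
      fix P assume P: "P \<in> topspace X - S"
      then obtain U \<phi> r where d: "disc_at P U \<phi> r"
        using disc_or_flat[of P "topspace X"] unfolding S_def by blast
      have "Q \<notin> S" if Q: "Q \<in> disc U \<phi> P r" for Q
      proof
        assume "Q \<in> S"
        then obtain N where N: "openin X N" "Q \<in> N" "N \<subseteq> Z" by (auto simp: S_def)
        obtain R where "R \<in> N \<inter> disc U \<phi> P r" "R \<notin> {P}"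
          using open_minus_finite_nonempty[of "N \<inter> disc U \<phi> P r" "{P}"] N Q openin_disc[OF d] by blast
        then show False using disc_no_zero[OF d, of R] N by blast
      qed
      then show "\<exists>T. openin X T \<and> P \<in> T \<and> T \<subseteq> topspace X - S"
        using openin_disc[OF d] centre_in_disc[OF d] openin_subset[OF openin_disc[OF d]]
        by (intro exI[of _ "disc U \<phi> P r"]) blast
    qed
  qed (auto simp: S_def)
  ultimately have "S = {} \<or> S = topspace X"
    using connected_surface unfolding connected_space_clopen_in by blast
  then show ?thesis using nonzero_point openin_subset[of X N] unfolding S_def by blast
qed

lemma disc_exists:
  assumes "openin X N" and "P \<in> N"
  shows "\<exists>U \<phi> r. disc_at P U \<phi> r \<and> disc U \<phi> P r \<subseteq> N"
proof -
  have "P \<in> topspace X" using openin_subset[OF assms(1)] assms(2) by blast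
  then show ?thesis using disc_or_flat[OF _ assms] no_flat_point by blast
qed

lemma eventually_no_zero: "\<forall>\<^sub>F Q in atin X P. Q \<notin> Z"
proof (cases "P \<in> topspace X")
  case True
  then obtain U \<phi> r where d: "disc_at P U \<phi> r" using disc_exists[of "topspace X"] by blast
  then show ?thesis
    unfolding eventually_atin using openin_disc[OF d] centre_in_disc[OF d] disc_no_zero[OF d] by blast
qed (simp add: eventually_atin)

lemma disc_inverse:
  assumes d: "disc_at P U \<phi> r" and z: "z \<in> ball (\<phi> P) r"
  shows "inv_into U \<phi> z \<in> disc U \<phi> P r" and "\<phi> (inv_into U \<phi> z) = z"
    and "z \<noteq> \<phi> P \<Longrightarrow> inv_into U \<phi> z \<noteq> P"
proof -
  have "z \<in> \<phi> ` U" using d z by (auto simp: disc_at_def)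
  then show 1: "\<phi> (inv_into U \<phi> z) = z" by (rule f_inv_into_f)
  then show "inv_into U \<phi> z \<in> disc U \<phi> P r"
    using inv_into_into[OF \<open>z \<in> \<phi> ` U\<close>] z by (simp add: disc_def)
  show "z \<noteq> \<phi> P \<Longrightarrow> inv_into U \<phi> z \<noteq> P" using 1 by auto
qed

lemma disc_inverse_chart:
  assumes d: "disc_at P U \<phi> r" and Q: "Q \<in> disc U \<phi> P r"
  shows "inv_into U \<phi> (\<phi> Q) = Q"
  using chart_inj[OF atlas_chart, of U \<phi>] d Q
    by (auto simp: disc_at_def disc_def intro: inv_into_f_f)

lemma disc_inverse_continuous:
  assumes d: "disc_at P U \<phi> r"
  shows "continuous_map (top_of_set (ball (\<phi> P) r)) (subtopology X (disc U \<phi> P r)) (inv_into U \<phi>)"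
proof (rule continuous_map_into_subtopology)
  have U: "(U, \<phi>) \<in> \<A>" "ball (\<phi> P) r \<subseteq> \<phi> ` U"
    using d by (auto simp: disc_at_def)
  show "continuous_map (top_of_set (ball (\<phi> P) r)) X (inv_into U \<phi>)"
    using continuous_map_from_subtopology_mono[OF chart_inverse_continuous[OF atlas_chart[OF U(1)]] U(2)] .
qed (use disc_inverse(1)[OF d] in auto)

lemma eventually_disc_inverse:
  assumes d: "disc_at P U \<phi> r" and z: "z \<in> ball (\<phi> P) r"
    and ev: "\<forall>\<^sub>F Q in nhdsin X (inv_into U \<phi> z). \<Phi> Q"
  shows "\<exists>e>0. ball z e \<subseteq> ball (\<phi> P) r \<and> (\<forall>w \<in> ball z e. \<Phi> (inv_into U \<phi> w))"
proof -
  let ?Q = "inv_into U \<phi> z"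
  have Q: "?Q \<in> disc U \<phi> P r" "\<phi> ?Q = z" using disc_inverse[OF d z] by auto
  then have "?Q \<in> topspace X" using openin_subset[OF openin_disc[OF d]] by blast
  then obtain N where N: "openin X N" "?Q \<in> N" "\<And>R. R \<in> N \<Longrightarrow> \<Phi> R"
    using ev unfolding eventually_nhdsin by blast
  have U: "(U, \<phi>) \<in> \<A>" "?Q \<in> U" using d Q by (auto simp: disc_at_def disc_def)
  obtain e where e: "e > 0" "ball z e \<subseteq> \<phi> ` (U \<inter> (N \<inter> disc U \<phi> P r))"
    using chart_ball_in[OF U, of "N \<inter> disc U \<phi> P r"] N Q openin_disc[OF d] by auto
  have "ball z e \<subseteq> ball (\<phi> P) r" using e(2) by (auto simp: disc_def)
  moreover have "\<Phi> (inv_into U \<phi> w)" if "w \<in> ball z e" for w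
  proof -
    have "w \<in> \<phi> ` (U \<inter> (N \<inter> disc U \<phi> P r))"
      using e(2) that by (rule subsetD)
    then obtain R where "w = \<phi> R" "R \<in> U \<inter> (N \<inter> disc U \<phi> P r)"
      by (rule imageE)
    then show ?thesis using N(3) disc_inverse_chart[OF d] by simp
  qed
  ultimately show ?thesis using e(1) by blast
qed

text \<open>In the coordinate of a disc the function has derivative \<open>0\<close> off the centre and is continuous in
  the centre, so it is constant. All comparisons of local primitives at a zero of \<open>q\<close> reduce to this.\<close>

lemma locally_constant_removable:
  fixes D :: "'a \<Rightarrow> complex"
  assumes N: "openin X N" "P \<in> N" and cont: "continuous_map (subtopology X N) euclidean D"
    and ev: "\<forall>\<^sub>F Q in atin X P. \<forall>\<^sub>F R in nhdsin X Q. D R = D Q"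
  shows "\<forall>\<^sub>F Q in nhdsin X P. D Q = D P"
proof -
  have PX: "P \<in> topspace X" using openin_subset[OF N(1)] N(2) by blast
  then obtain N' where N': "openin X N'" "P \<in> N'" "\<And>Q. Q \<in> N' - {P} \<Longrightarrow> \<forall>\<^sub>F R in nhdsin X Q. D R = D Q"
    using ev unfolding eventually_atin by blast
  obtain U \<phi> r where d: "disc_at P U \<phi> r" and sub: "disc U \<phi> P r \<subseteq> N \<inter> N'"
    using disc_exists[OF openin_Int[OF N(1) N'(1)], of P] N(2) N'(2) by blast
  let ?B = "ball (\<phi> P) r"
  define h where "h = D \<circ> inv_into U \<phi>"
  have "continuous_map (top_of_set ?B) euclidean h"
    unfolding h_def
    by (rule continuous_map_compose[OF disc_inverse_continuous[OF d]])
       (use continuous_map_from_subtopology_mono[OF cont] sub in blast)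
  then have "continuous_on ?B h" by simp
  moreover have "(h has_field_derivative 0) (at z)" if z: "z \<in> ?B - {\<phi> P}" for z
  proof -
    have zB: "z \<in> ?B" using z by blast
    have "inv_into U \<phi> z \<in> N' - {P}" using disc_inverse[OF d zB] z sub by blast
    from eventually_disc_inverse[OF d zB N'(3)[OF this]] obtain e where e: "e > 0" "\<forall>w \<in> ball z e. D (inv_into U \<phi> w) = D (inv_into U \<phi> z)"
      by blast
    have const: "h z = h w" if "w \<in> ball z e" for w
      using e(2) that unfolding h_def o_apply by metis
    show ?thesis
    proof (rule has_field_derivative_transform_within_open[OF DERIV_const open_ball])
      show "z \<in> ball z e" using e(1) by simp
    qed (rule const)
  qed
  ultimately obtain c where c: "\<And>z. z \<in> ?B \<Longrightarrow> h z = c"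
    using DERIV_zero_connected_constant[of ?B "{\<phi> P}" h] by auto
  have "D Q = c" if "Q \<in> disc U \<phi> P r" for Q
    using c[of "\<phi> Q"] disc_inverse_chart[OF d that] that by (auto simp: h_def disc_def)
  then show ?thesis
    unfolding eventually_nhdsin using openin_disc[OF d] centre_in_disc[OF d] by metis
qed

end

section \<open>The abelian differential of a translation surface\<close>

context flat_surface begin

lemma translation_chartD:
  assumes "(V, \<zeta>) \<in> \<mu>"
  shows "V \<subseteq> topspace X - Z" and "complex_chart X (V, \<zeta>)"
    and "(U, \<phi>) \<in> \<A> \<Longrightarrow> P \<in> U \<Longrightarrow> P \<in> V \<Longrightarrow>
      \<exists>s. s\<^sup>2 = q (U, \<phi>) (\<phi> P) \<and> (\<zeta> \<circ> inv_into U \<phi> has_field_derivative s) (at (\<phi> P))"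
proof -
  have "(V, \<zeta>) \<in> flat_charts X \<A> q"
    using surface_parts(3) assms unfolding translation_structure_def by (elim conjE) (rule subsetD)
  then have *: "V \<subseteq> topspace X - Z \<and> complex_chart X (V, \<zeta>) \<and>
     (\<forall>(U, \<phi>)\<in>\<A>. \<exists>s. \<forall>z \<in> \<phi> ` (V \<inter> U). (s z)\<^sup>2 = q (U, \<phi>) z \<and>
        (transition (U, \<phi>) (V, \<zeta>) has_field_derivative s z) (at z))"
    unfolding flat_charts_def by simp
  then show "V \<subseteq> topspace X - Z" "complex_chart X (V, \<zeta>)" by simp_all
  assume U: "(U, \<phi>) \<in> \<A>" "P \<in> U" "P \<in> V"
  have "\<forall>(U, \<phi>)\<in>\<A>. \<exists>s. \<forall>z \<in> \<phi> ` (V \<inter> U). (s z)\<^sup>2 = q (U, \<phi>) z \<and>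
        (transition (U, \<phi>) (V, \<zeta>) has_field_derivative s z) (at z)"
    using * by (elim conjE)
  from bspec[OF this U(1)] obtain s where s: "\<forall>z \<in> \<phi> ` (V \<inter> U). (s z)\<^sup>2 = q (U, \<phi>) z \<and>
        (transition (U, \<phi>) (V, \<zeta>) has_field_derivative s z) (at z)"
    unfolding prod.case by (elim exE)
  have "\<phi> P \<in> \<phi> ` (V \<inter> U)" using U by blast
  from bspec[OF s this] show "\<exists>s. s\<^sup>2 = q (U, \<phi>) (\<phi> P) \<and> (\<zeta> \<circ> inv_into U \<phi> has_field_derivative s) (at (\<phi> P))"
    unfolding transition_def prod.case by (rule exI)
qed

lemma translation_chart_cover:
  assumes "Q \<in> topspace X" and "Q \<notin> Z"
  shows "\<exists>V \<zeta>. (V, \<zeta>) \<in> \<mu> \<and> Q \<in> V"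
proof -
  have "\<Union> (fst ` \<mu>) = topspace X - Z"
    using surface_parts(3) unfolding translation_structure_def by (elim conjE)
  then have "Q \<in> \<Union> (fst ` \<mu>)" using assms by blast
  then show ?thesis by force
qed

lemma translation_charts_compatible:
  assumes V: "(V, \<zeta>) \<in> \<mu>" "(W, \<xi>) \<in> \<mu>" and Q: "Q \<in> V" "Q \<in> W"
  shows "\<forall>\<^sub>F R in nhdsin X Q. \<xi> R - \<xi> Q = \<zeta> R - \<zeta> Q"
proof -
  have "\<forall>(U, \<zeta>)\<in>\<mu>. \<forall>(V, \<xi>)\<in>\<mu>. \<forall>P \<in> U \<inter> V. \<exists>c W.
        openin X W \<and> P \<in> W \<and> W \<subseteq> U \<inter> V \<and> (\<forall>Q\<in>W. \<xi> Q = \<zeta> Q + c)"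
    using surface_parts(3) unfolding translation_structure_def by (elim conjE)
  from bspec[OF bspec[OF this V(1), unfolded prod.case] V(2), unfolded prod.case] Q
  obtain c N where "openin X N" "Q \<in> N" "\<forall>R\<in>N. \<xi> R = \<zeta> R + c" by blast
  then show ?thesis unfolding eventually_nhdsin by (intro disjI2 exI[of _ N]) simp
qed

text \<open>\<open>F\<close> has the same increments near \<open>Q\<close> as the charts of the translation structure; no condition
  if \<open>Q\<close> is a zero of \<open>q\<close>, where there is no such chart.\<close>

definition flat_near :: "('a \<Rightarrow> complex) \<Rightarrow> 'a \<Rightarrow> bool" where
  "flat_near F Q \<longleftrightarrow> (\<forall>(V, \<zeta>)\<in>\<mu>. Q \<in> V \<longrightarrow> (\<forall>\<^sub>F R in nhdsin X Q. F R - F Q = \<zeta> R - \<zeta> Q))"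

text \<open>Flatness is required on punctured neighbourhoods only. This covers the zeros of \<open>q\<close>, where
  continuity takes over.\<close>

definition primitives :: "('a set \<times> ('a \<Rightarrow> complex)) set" where
  "primitives = {(U, F). openin X U \<and> continuous_map (subtopology X U) euclidean F \<and>
     (\<forall>P\<in>U. \<forall>\<^sub>F Q in atin X P. flat_near F Q)}"

lemma flat_nearD:
  "flat_near F Q \<Longrightarrow> (V, \<zeta>) \<in> \<mu> \<Longrightarrow> Q \<in> V \<Longrightarrow> \<forall>\<^sub>F R in nhdsin X Q. F R - F Q = \<zeta> R - \<zeta> Q"
  unfolding flat_near_def by (drule bspec) auto

lemma eventually_nhdsin_outside: "Q \<notin> topspace X \<Longrightarrow> eventually \<Phi> (nhdsin X Q)"
  by (simp add: eventually_nhdsin)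

lemma primitives_compatible:
  assumes F: "(U, F) \<in> primitives" and G: "(V, G) \<in> primitives" and P: "P \<in> U" "P \<in> V"
  shows "\<forall>\<^sub>F Q in nhdsin X P. F Q - F P = G Q - G P"
proof -
  have U: "openin X U" "continuous_map (subtopology X U) euclidean F" "\<forall>\<^sub>F Q in atin X P. flat_near F Q"
    using F P unfolding primitives_def by auto
  have V: "openin X V" "continuous_map (subtopology X V) euclidean G" "\<forall>\<^sub>F Q in atin X P. flat_near G Q"
    using G P unfolding primitives_def by auto
  have "\<forall>\<^sub>F Q in nhdsin X P. F Q - G Q = F P - G P"
  proof (rule locally_constant_removable[of "U \<inter> V"])
    show "continuous_map (subtopology X (U \<inter> V)) euclidean (\<lambda>Q. F Q - G Q)"
      by (intro continuous_map_diff continuous_map_from_subtopology_mono[OF U(2)]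
          continuous_map_from_subtopology_mono[OF V(2)]) auto
    show "\<forall>\<^sub>F Q in atin X P. \<forall>\<^sub>F R in nhdsin X Q. F R - G R = F Q - G Q"
      using U(3) V(3) eventually_no_zero[of P]
    proof eventually_elim
      case (elim Q)
      show ?case
      proof (cases "Q \<in> topspace X")
        case True
        then obtain W \<zeta> where W: "(W, \<zeta>) \<in> \<mu>" "Q \<in> W"
          using translation_chart_cover[OF True elim(3)] by blast
        from flat_nearD[OF elim(1) W] flat_nearD[OF elim(2) W] show ?thesis
          by eventually_elim (simp add: diff_eq_eq)
      qed (rule eventually_nhdsin_outside)
    qed
  qed (use U V P in auto)
  then show ?thesis by eventually_elim (simp add: algebra_simps)
qed

text \<open>Off the centre, \<open>s\<close> is the derivative of any chart of the translation structure in the coordinate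
  of the disc. It is holomorphic there, and bounded near the centre because \<open>s\<^sup>2 = q\<close> is;
  so the singularity is removable.\<close>

lemma square_root_exists:
  assumes d: "disc_at P U \<phi> r"
  shows "\<exists>s. s holomorphic_on ball (\<phi> P) r \<and> (\<forall>z \<in> ball (\<phi> P) r - {\<phi> P}. s z \<noteq> 0 \<and>
    (\<forall>(V, \<zeta>)\<in>\<mu>. inv_into U \<phi> z \<in> V \<longrightarrow> (\<zeta> \<circ> inv_into U \<phi> has_field_derivative s z) (at z)))"
proof -
  let ?B = "ball (\<phi> P) r" and ?g = "inv_into U \<phi>"
  have U: "(U, \<phi>) \<in> \<A>" "r > 0" "?B \<subseteq> \<phi> ` U" and q0: "\<And>z. z \<in> ?B - {\<phi> P} \<Longrightarrow> q (U, \<phi>) z \<noteq> 0"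
    using d by (auto simp: disc_at_def)
  have g: "?g z \<in> topspace X - Z" if "z \<in> ?B - {\<phi> P}" for z
    using disc_inverse[OF d, of z] disc_no_zero[OF d, of "?g z"] openin_subset[OF openin_disc[OF d]] that by blast
  define s where "s z = (SOME w. w\<^sup>2 = q (U, \<phi>) z \<and> (\<exists>(V, \<zeta>)\<in>\<mu>. ?g z \<in> V \<and> (\<zeta> \<circ> ?g has_field_derivative w) (at z)))" for z
  have chart_deriv: "\<exists>w. w\<^sup>2 = q (U, \<phi>) z \<and> (\<zeta> \<circ> ?g has_field_derivative w) (at z)"
    if z: "z \<in> ?B" and V: "(V, \<zeta>) \<in> \<mu>" "?g z \<in> V" for z V \<zeta>
    using translation_chartD(3)[OF V(1) U(1) _ V(2)] disc_inverse(1,2)[OF d z] by (simp add: disc_def)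
  have s: "(s z)\<^sup>2 = q (U, \<phi>) z" "\<And>V \<zeta>. (V, \<zeta>) \<in> \<mu> \<Longrightarrow> ?g z \<in> V \<Longrightarrow> (\<zeta> \<circ> ?g has_field_derivative s z) (at z)"
    if z: "z \<in> ?B - {\<phi> P}" for z
  proof -
    have zB: "z \<in> ?B" using z by blast
    obtain V \<zeta> where "(V, \<zeta>) \<in> \<mu>" "?g z \<in> V"
      using translation_chart_cover g[OF z] by blast
    with chart_deriv[OF zB this] have "\<exists>w. w\<^sup>2 = q (U, \<phi>) z \<and> (\<exists>(V, \<zeta>)\<in>\<mu>. ?g z \<in> V \<and> (\<zeta> \<circ> ?g has_field_derivative w) (at z))"
      by blast
    from someI_ex[OF this] have sz: "(s z)\<^sup>2 = q (U, \<phi>) z \<and> (\<exists>(V, \<zeta>)\<in>\<mu>. ?g z \<in> V \<and> (\<zeta> \<circ> ?g has_field_derivative s z) (at z))"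
      unfolding s_def[symmetric] .
    then show "(s z)\<^sup>2 = q (U, \<phi>) z" by (rule conjunct1)
    obtain V \<zeta> where V: "(V, \<zeta>) \<in> \<mu>" "?g z \<in> V" "(\<zeta> \<circ> ?g has_field_derivative s z) (at z)"
      using conjunct2[OF sz] by blast
    fix W \<xi> assume W: "(W, \<xi>) \<in> \<mu>" "?g z \<in> W"
    obtain e where e: "e > 0" "\<forall>w \<in> ball z e. \<xi> (?g w) - \<xi> (?g z) = \<zeta> (?g w) - \<zeta> (?g z)"
      using eventually_disc_inverse[OF d zB translation_charts_compatible[OF V(1) W(1) V(2) W(2)]]
        by blast
    have "((\<lambda>w. (\<zeta> \<circ> ?g) w + (\<xi> (?g z) - \<zeta> (?g z))) has_field_derivative s z + 0) (at z)"
      by (intro DERIV_add V(3) DERIV_const)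
    then have "((\<lambda>w. (\<zeta> \<circ> ?g) w + (\<xi> (?g z) - \<zeta> (?g z))) has_field_derivative s z) (at z)" by simp
    then show "(\<xi> \<circ> ?g has_field_derivative s z) (at z)"
    proof (rule has_field_derivative_transform_within_open[OF _ open_ball])
      show "z \<in> ball z e" using e(1) by simp
      fix w assume "w \<in> ball z e"
      from bspec[OF e(2) this] show "(\<zeta> \<circ> ?g) w + (\<xi> (?g z) - \<zeta> (?g z)) = (\<xi> \<circ> ?g) w"
        by (simp add: algebra_simps)
    qed
  qed
  have "\<exists>s'. (s has_field_derivative s') (at z)" if z: "z \<in> ?B - {\<phi> P}" for z
  proof -
    have zB: "z \<in> ?B" using z by blast
    obtain V \<zeta> where V: "(V, \<zeta>) \<in> \<mu>" "?g z \<in> V"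
      using translation_chart_cover g[OF z] by blast
    have "\<forall>\<^sub>F R in nhdsin X (?g z). R \<in> V"
      unfolding eventually_nhdsin using chart_openin[OF translation_chartD(2)[OF V(1)]] V(2) by blast
    then obtain e where e: "e > 0" "ball z e \<subseteq> ?B" "\<forall>w \<in> ball z e. ?g w \<in> V"
      using eventually_disc_inverse[OF d zB] by blast
    let ?T = "ball z e - {\<phi> P}"
    have T: "open ?T" "z \<in> ?T" using z e(1) by (auto intro: open_delete)
    have D: "(\<zeta> \<circ> ?g has_field_derivative s w) (at w)" if "w \<in> ?T" for w
      using s(2)[of w, OF _ V(1)] that e(2,3) by blast
    then have "(\<zeta> \<circ> ?g) holomorphic_on ?T" using holomorphic_on_open[OF T(1)] by blast
    then have "deriv (\<zeta> \<circ> ?g) holomorphic_on ?T" using T(1) by (rule holomorphic_deriv)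
    then have "s holomorphic_on ?T"
      by (rule holomorphic_transform) (use D DERIV_imp_deriv in blast)
    then show ?thesis using holomorphic_on_open[OF T(1)] T(2) by blast
  qed
  then have hol: "s holomorphic_on ?B - {\<phi> P}"
    by (subst holomorphic_on_open) (auto intro: open_delete)
  \<comment> \<open>With \<open>c\<close> the value of \<open>|q|\<close> in the centre, \<open>|s|\<^sup>2 = |q| < c + 1 \<le> (c + 2)\<^sup>2\<close> nearby.\<close>
  have "\<forall>\<^sub>F z in at (\<phi> P). norm (s z) \<le> norm (q (U, \<phi>) (\<phi> P)) + 2"
  proof -
    have "continuous_on ?B (q (U, \<phi>))"
      using holomorphic_on_imp_continuous_on[OF q_holomorphic[OF U(1)]] U(3)
        by (rule continuous_on_subset)
    then have "isCont (q (U, \<phi>)) (\<phi> P)"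
      using U(2) by (simp add: continuous_on_eq_continuous_at)
    then have "(\<lambda>z. norm (q (U, \<phi>) z)) \<midarrow>\<phi> P\<rightarrow> norm (q (U, \<phi>) (\<phi> P))"
      by (intro tendsto_norm) (simp add: isCont_def)
    then have "\<forall>\<^sub>F z in at (\<phi> P). norm (q (U, \<phi>) z) < norm (q (U, \<phi>) (\<phi> P)) + 1"
      by (rule order_tendstoD) simp
    moreover have "\<forall>\<^sub>F z in at (\<phi> P). z \<in> ?B - {\<phi> P}"
      using U(2) by (intro eventually_at_in_open) auto
    ultimately show ?thesis
    proof eventually_elim
      case (elim z)
      have "(norm (s z))\<^sup>2 = norm (q (U, \<phi>) z)" using s(1)[OF elim(2)] by (metis norm_power)
      then have "(norm (s z))\<^sup>2 \<le> (norm (q (U, \<phi>) (\<phi> P)) + 2)\<^sup>2"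
        using elim(1) by (simp add: power2_eq_square algebra_simps) 
          (smt (verit) mult_nonneg_nonneg norm_ge_zero)
      then show ?case by (rule power2_le_imp_le) simp
    qed
  qed
  then obtain t where t: "t holomorphic_on ?B" "\<forall>z\<in>?B - {\<phi> P}. t z = s z"
    using holomorphic_on_extend_bounded[OF hol] U(2) by (auto simp: interior_open)
  have "t z \<noteq> 0 \<and> (\<forall>(V, \<zeta>)\<in>\<mu>. ?g z \<in> V \<longrightarrow> (\<zeta> \<circ> ?g has_field_derivative t z) (at z))"
    if z: "z \<in> ?B - {\<phi> P}" for z
  proof -
    have "s z \<noteq> 0" using s(1)[OF z] q0[OF z] by auto
    then show ?thesis using bspec[OF t(2) z] s(2)[OF z] by auto
  qed
  then show ?thesis using t(1) by blast
qed

text \<open>A primitive of the square root of \<open>q\<close> in the coordinate of the disc. It is an open map by the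
  open mapping theorem, as its derivative does not vanish off the centre. This holds in particular
  at the zeros of \<open>q\<close>, where it is not injective.\<close>

lemma primitive_on_disc:
  assumes d: "disc_at P U \<phi> r"
  shows "\<exists>F. (disc U \<phi> P r, F) \<in> primitives \<and>
    (\<forall>W. openin X W \<and> W \<subseteq> disc U \<phi> P r \<longrightarrow> open (F ` W))"
proof -
  let ?B = "ball (\<phi> P) r" and ?g = "inv_into U \<phi>" and ?D = "disc U \<phi> P r"
  have U: "(U, \<phi>) \<in> \<A>" "r > 0" using d by (auto simp: disc_at_def)
  obtain s where s: "s holomorphic_on ?B" and s': "\<forall>z \<in> ?B - {\<phi> P}. s z \<noteq> 0 \<and>
    (\<forall>(V, \<zeta>)\<in>\<mu>. ?g z \<in> V \<longrightarrow> (\<zeta> \<circ> ?g has_field_derivative s z) (at z))"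
    using square_root_exists[OF d] by blast
  obtain F0 where "\<And>z. z \<in> ?B \<Longrightarrow> (F0 has_field_derivative s z) (at z within ?B)"
    using holomorphic_convex_primitive'[OF convex_ball open_ball s] by blast
  then have F0: "(F0 has_field_derivative s z) (at z)" if "z \<in> ?B" for z
    using that by (metis at_within_open open_ball)
  define F where "F = F0 \<circ> \<phi>"
  have flat: "flat_near F Q" if Q: "Q \<in> ?D" "Q \<noteq> P" for Q
    unfolding flat_near_def
  proof (clarify)
    fix V \<zeta> assume V: "(V, \<zeta>) \<in> \<mu>" "Q \<in> V"
    let ?z = "\<phi> Q"
    have gz: "?g ?z = Q" by (rule disc_inverse_chart[OF d Q(1)])
    have z: "?z \<in> ?B" using Q(1) by (simp add: disc_def)
    have "?z \<noteq> \<phi> P" using gz disc_inverse_chart[OF d centre_in_disc[OF d]] Q(2) by metis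
    have "\<forall>\<^sub>F R in nhdsin X (?g ?z). R \<in> V"
      unfolding eventually_nhdsin gz using chart_openin[OF translation_chartD(2)[OF V(1)]] V(2) by blast
    then obtain e where e: "e > 0" "ball ?z e \<subseteq> ?B" "\<forall>w \<in> ball ?z e. ?g w \<in> V"
      using eventually_disc_inverse[OF d z] by blast
    \<comment> \<open>A ball of this radius around \<open>\<phi> Q\<close> misses the centre of the disc.\<close>
    let ?e = "min e (dist ?z (\<phi> P))"
    have sub: "ball ?z ?e \<subseteq> ?B - {\<phi> P}" using e(2) by auto
    have "(\<lambda>w. F0 w - (\<zeta> \<circ> ?g) w) constant_on ball ?z ?e"
    proof (rule has_field_derivative_0_imp_constant_on)
      fix w assume w: "w \<in> ball ?z ?e"
      have "?g w \<in> V" using e(3) w by simp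
      then have "(\<zeta> \<circ> ?g has_field_derivative s w) (at w)"
        using bspec[OF s' subsetD[OF sub w]] V(1) by blast
      then have "((\<lambda>w. F0 w - (\<zeta> \<circ> ?g) w) has_field_derivative s w - s w) (at w)"
        by (rule DERIV_diff[OF F0[OF DiffD1[OF subsetD[OF sub w]]]])
      then show "((\<lambda>w. F0 w - (\<zeta> \<circ> ?g) w) has_field_derivative 0) (at w)" by simp
    qed auto
    then obtain c where c: "\<And>w. w \<in> ball ?z ?e \<Longrightarrow> F0 w - (\<zeta> \<circ> ?g) w = c"
      unfolding constant_on_def by blast
    let ?N = "{R \<in> U. \<phi> R \<in> ball ?z ?e} \<inter> ?D"
    have "F R = \<zeta> R + c" if "R \<in> ?N" for R
      using c[of "\<phi> R"] that disc_inverse_chart[OF d, of R] by (simp add: F_def algebra_simps)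
    moreover have "openin X ?N"
      by (intro openin_Int chart_open_preimage[OF atlas_chart[OF U(1)]] openin_disc[OF d] open_ball)
    moreover have "Q \<in> ?N" using Q(1) e(1) \<open>?z \<noteq> \<phi> P\<close>
      by (simp add: disc_def)
    ultimately show "\<forall>\<^sub>F R in nhdsin X Q. F R - F Q = \<zeta> R - \<zeta> Q"
      unfolding eventually_nhdsin by (intro disjI2 exI[of _ ?N]) simp
  qed
  have "(?D, F) \<in> primitives"
  proof -
    have "continuous_map (subtopology X ?D) euclidean F"
      unfolding F_def
    proof (rule continuous_map_compose)
      show "continuous_map (subtopology X ?D) (top_of_set ?B) \<phi>"
      proof (rule continuous_map_into_subtopology)
        show "continuous_map (subtopology X ?D) euclidean \<phi>"
          by (rule continuous_map_from_subtopology_mono[OF chart_continuous[OF atlas_chart[OF U(1)]]])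
             (auto simp: disc_def)
      qed (auto simp: disc_def)
      have "continuous_on ?B F0"
        using F0 by (meson DERIV_isCont continuous_at_imp_continuous_on)
      then show "continuous_map (top_of_set ?B) euclidean F0" by simp
    qed
    moreover have "\<forall>\<^sub>F Q in atin X P'. flat_near F Q" if P': "P' \<in> ?D" for P'
    proof -
      \<comment> \<open>The disc without its centre, unless \<open>P'\<close> is the centre itself.\<close>
      have "openin X (?D - ({P} - {P'}))"
        using openin_disc[OF d] centre_in_disc[OF d] openin_subset[OF openin_disc[OF d]] Hausdorff_surface
        by (intro openin_diff) (auto intro!: closedin_Hausdorff_finite)
      then show ?thesis unfolding eventually_atin using P' flat by blast
    qed
    ultimately show ?thesis using openin_disc[OF d] by (simp add: primitives_def)
  qed
  moreover have "open (F ` W)" if W: "openin X W" "W \<subseteq> ?D" for W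
  proof -
    have "W \<subseteq> U" using W(2) by (auto simp: disc_def)
    then have "open (\<phi> ` W)" by (rule chart_open_image[OF atlas_chart[OF U(1)] W(1)])
    moreover have "\<phi> ` W \<subseteq> ?B" using W(2) by (auto simp: disc_def)
    moreover have "F0 holomorphic_on ?B" using F0 holomorphic_on_open[OF open_ball] by blast
    moreover have "\<not> F0 constant_on ?B"
    proof
      assume "F0 constant_on ?B"
      then obtain c where c: "\<And>z. z \<in> ?B \<Longrightarrow> F0 z = c"
        unfolding constant_on_def by blast
      define z where "z = \<phi> P + of_real (r / 2)"
      have z: "z \<in> ?B - {\<phi> P}" using U(2) by (simp add: z_def dist_norm)
      have "(F0 has_field_derivative 0) (at z)"
        by (rule has_field_derivative_transform_within_open[OF DERIV_const[of c] open_ball])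
           (use z c in auto)
      then have "s z = 0" using F0[of z] z DERIV_unique by blast
      then show False using bspec[OF s' z] by simp
    qed
    ultimately have "open (F0 ` \<phi> ` W)"
      using open_mapping_thm[of F0 ?B "\<phi> ` W"] by simp
    then show ?thesis by (simp add: F_def image_comp)
  qed
  ultimately show ?thesis by blast
qed

sublocale local_primitives X primitives
proof
  show "openin X U" if "(U, F) \<in> primitives" for U F using that by (simp add: primitives_def)
  show "\<exists>U F. (U, F) \<in> primitives \<and> P \<in> U" if P: "P \<in> topspace X" for P
  proof -
    obtain U \<phi> r where d: "disc_at P U \<phi> r" using disc_exists[OF openin_topspace P] by blast
    then show ?thesis using primitive_on_disc[OF d] centre_in_disc[OF d] by blast
  qed
  show "\<exists>W. openin X W \<and> P \<in> W \<and> W \<subseteq> U \<inter> V \<and> (\<forall>Q\<in>W. F Q - F P = G Q - G P)"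
    if H: "(U, F) \<in> primitives" "(V, G) \<in> primitives" "P \<in> U" "P \<in> V" for U F V G P
  proof -
    have UV: "openin X U" "openin X V" using H by (simp_all add: primitives_def)
    then have "P \<in> topspace X" using H(3) openin_subset by blast
    then obtain N where "openin X N" "P \<in> N" "\<forall>Q\<in>N. F Q - F P = G Q - G P"
      using primitives_compatible[OF H] unfolding eventually_nhdsin by blast
    then show ?thesis using UV H by (intro exI[of _ "N \<inter> (U \<inter> V)"]) auto
  qed
qed

end

section \<open>Affine homeomorphisms\<close>

lemma plane_action_diff: "plane_action A (z - w) = plane_action A z - plane_action A w"
  by (simp add: plane_action_def complex_eq_iff algebra_simps)

lemma continuous_on_plane_action: "continuous_on S (plane_action A)"
  unfolding plane_action_def by (intro continuous_intros)

lemma plane_action_determines: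
  assumes "A \<in> carrier_mat 2 2" and "B \<in> carrier_mat 2 2" and "e > 0"
    and eq: "\<And>z. z \<in> ball 0 e \<Longrightarrow> plane_action A z = plane_action B z"
  shows "A = B"
proof -
  have "complex_of_real (e / 2) \<in> ball 0 e" "\<i> * of_real (e / 2) \<in> ball 0 e"
    using \<open>e > 0\<close> by (simp_all add: dist_norm norm_mult)
  from eq[OF this(1)] eq[OF this(2)]
  have "A $$ (i, j) = B $$ (i, j)" if "i < 2" "j < 2" for i j
    using that \<open>e > 0\<close> by (auto simp: plane_action_def less_2_cases_iff)
  then show ?thesis using assms(1,2) by (intro eq_matI) auto
qed

context flat_surface begin

text \<open>The surface without the zeros of \<open>q\<close> is connected, because punctured discs are. Instead of
  treating it as a space of its own, one considers all points, zeros included, such that \<open>k\<close> has the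
  prescribed value on a punctured neighbourhood. They form a nonempty open and closed set.\<close>

lemma constant_off_zeros:
  assumes k: "\<And>Q. Q \<in> topspace X - Z \<Longrightarrow> \<forall>\<^sub>F R in nhdsin X Q. k R = k Q"
    and Q0: "Q0 \<in> topspace X - Z" and Q1: "Q1 \<in> topspace X - Z"
  shows "k Q1 = k Q0"
proof -
  define S where "S = {P \<in> topspace X. \<forall>\<^sub>F Q in atin X P. k Q = k Q0}"
  have nhd: "\<exists>N. openin X N \<and> Q \<in> N \<and> (\<forall>R\<in>N. k R = k Q)"
    if "Q \<in> topspace X - Z" for Q
    using k[OF that] that unfolding eventually_nhdsin by blast
  have ptd: "\<exists>N. openin X N \<and> P \<in> N \<and> (\<forall>R\<in>N - {P}. k R = k Q0)"
    if "P \<in> S" for P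
    using that unfolding S_def eventually_atin by blast
  have sing: "closedin X {P}" if "P \<in> topspace X" for P
    using that closedin_Hausdorff_finite[OF Hausdorff_surface, of "{P}"] by simp
  have "openin X S"
  proof (subst openin_subopen, intro ballI)
    fix P assume "P \<in> S"
    then obtain N where N: "openin X N" "P \<in> N" "\<forall>R\<in>N - {P}. k R = k Q0"
      using ptd by blast
    have PX: "P \<in> topspace X" using openin_subset[OF N(1)] N(2) by blast
    have "R \<in> S" if "R \<in> N" for R
    proof (cases "R = P")
      case False
      have "openin X (N - {P})" using N(1) sing[OF PX] by (rule openin_diff)
      then show ?thesis
        using that False N(3) openin_subset[OF N(1)] unfolding S_def eventually_atin by blast
    qed (use \<open>P \<in> S\<close> in simp)
    then show "\<exists>T. openin X T \<and> P \<in> T \<and> T \<subseteq> S" using N(1,2) by blast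
  qed
  moreover have "closedin X S"
    unfolding closedin_def
  proof
    show "openin X (topspace X - S)"
    proof (subst openin_subopen, intro ballI)
      fix P assume P: "P \<in> topspace X - S"
      then obtain U \<phi> r where d: "disc_at P U \<phi> r"
        using disc_exists[OF openin_topspace] by blast
      let ?B = "ball (\<phi> P) r - {\<phi> P}" and ?g = "inv_into U \<phi>"
      have "(\<lambda>z. k (?g z)) constant_on ?B"
      proof (rule locally_constant_imp_constant)
        show "connected ?B" by (rule connected_punctured_ball) simp
        fix z assume z: "z \<in> ?B"
        then have zB: "z \<in> ball (\<phi> P) r" by blast
        have "?g z \<in> topspace X - Z"
          using disc_inverse[OF d zB] disc_no_zero[OF d, of "?g z"] openin_subset[OF openin_disc[OF d]] z by blast
        then obtain e where e: "e > 0" "\<forall>w \<in> ball z e. k (?g w) = k (?g z)"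
          using eventually_disc_inverse[OF d zB k] by blast
        moreover have "openin (top_of_set ?B) (?B \<inter> ball z e)"
          by (rule openin_open_Int) (rule open_ball)
        moreover have "z \<in> ?B \<inter> ball z e" using z e(1) by simp
        ultimately show "\<exists>T. openin (top_of_set ?B) T \<and> z \<in> T \<and> (\<forall>w\<in>T. k (?g w) = k (?g z))"
          by blast
      qed
      then obtain B where B: "\<And>z. z \<in> ?B \<Longrightarrow> k (?g z) = B"
        unfolding constant_on_def by blast
      have kB: "k Q = B" if "Q \<in> disc U \<phi> P r" "Q \<noteq> P" for Q
      proof -
        have "\<phi> Q \<noteq> \<phi> P"
          using disc_inverse_chart[OF d that(1)] disc_inverse_chart[OF d centre_in_disc[OF d]] that(2)
            by metis
        then have "\<phi> Q \<in> ?B" using that(1) by (simp add: disc_def)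
        from B[OF this] show ?thesis using disc_inverse_chart[OF d that(1)] by simp
      qed
      have "B \<noteq> k Q0"
        using P kB openin_disc[OF d] centre_in_disc[OF d] unfolding S_def eventually_atin by blast
      have "Q \<notin> S" if Q: "Q \<in> disc U \<phi> P r" for Q
      proof
        assume "Q \<in> S"
        then obtain N where N: "openin X N" "Q \<in> N" "\<forall>R\<in>N - {Q}. k R = k Q0"
          using ptd by blast
        obtain R where "R \<in> N \<inter> disc U \<phi> P r" "R \<notin> {P, Q}"
          using open_minus_finite_nonempty[of "N \<inter> disc U \<phi> P r" "{P, Q}"] N Q openin_disc[OF d] by blast
        then show False using N(3) kB[of R] \<open>B \<noteq> k Q0\<close> by auto
      qed
      then show "\<exists>T. openin X T \<and> P \<in> T \<and> T \<subseteq> topspace X - S"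
        using openin_disc[OF d] centre_in_disc[OF d] openin_subset[OF openin_disc[OF d]]
        by (intro exI[of _ "disc U \<phi> P r"]) blast
    qed
  qed (auto simp: S_def)
  ultimately have "S = {} \<or> S = topspace X"
    using connected_surface unfolding connected_space_clopen_in by blast
  moreover have "Q0 \<in> S" using nhd[OF Q0] Q0 unfolding S_def eventually_atin by blast
  ultimately have "Q1 \<in> S" using Q1 by blast
  then obtain N where N: "openin X N" "Q1 \<in> N" "\<forall>R\<in>N - {Q1}. k R = k Q0"
    using ptd by blast
  obtain N' where N': "openin X N'" "Q1 \<in> N'" "\<forall>R\<in>N'. k R = k Q1"
    using nhd[OF Q1] by blast
  obtain R where "R \<in> N \<inter> N'" "R \<notin> {Q1}"
    using open_minus_finite_nonempty[of "N \<inter> N'" "{Q1}"] N N' by blast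
  then have "k R = k Q0" "k R = k Q1" using N(3) N'(3) by blast+
  then show ?thesis by simp
qed

end

locale affine_map = flat_surface +
  fixes f :: "'a \<Rightarrow> 'a"
  assumes affine: "f \<in> affine_group X \<mu>"
begin

lemma f_homeomorphic: "homeomorphic_map X X f"
  using affine by (simp add: affine_group_def)

lemmas f_continuous = homeomorphic_imp_continuous_map[OF f_homeomorphic]
  and f_inj = homeomorphic_imp_injective_map[OF f_homeomorphic]

lemma f_topspace: "Q \<in> topspace X \<Longrightarrow> f Q \<in> topspace X"
  using f_continuous by (auto simp: continuous_map_def)

lemma f_off_zeros:
  assumes "Q \<in> topspace X - Z"
  shows "f Q \<in> topspace X - Z"
proof -
  have "\<Union> (fst ` \<mu>) = topspace X - Z"
    using surface_parts(3) unfolding translation_structure_def by (elim conjE)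
  moreover have "f ` \<Union> (fst ` \<mu>) = \<Union> (fst ` \<mu>)"
    using affine by (simp add: affine_group_def)
  ultimately show ?thesis using assms by blast
qed

lemma eventually_nhdsin_f:
  assumes "\<forall>\<^sub>F R in nhdsin X (f Q). \<Phi> R"
  shows "\<forall>\<^sub>F R in nhdsin X Q. \<Phi> (f R)"
proof (cases "Q \<in> topspace X")
  case True
  then obtain N where "openin X N" "f Q \<in> N" "\<forall>R\<in>N. \<Phi> R"
    using assms f_topspace[OF True] unfolding eventually_nhdsin by blast
  moreover from this have "openin X {R \<in> topspace X. f R \<in> N}"
    using openin_continuous_map_preimage[OF f_continuous] by blast
  ultimately show ?thesis unfolding eventually_nhdsin using True
    by (intro disjI2 exI[of _ "{R \<in> topspace X. f R \<in> N}"]) blast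
qed (rule eventually_nhdsin_outside)

lemma eventually_atin_f:
  assumes P: "P \<in> topspace X" and "\<forall>\<^sub>F R in atin X (f P). \<Phi> R"
  shows "\<forall>\<^sub>F R in atin X P. \<Phi> (f R)"
proof -
  obtain N where N: "openin X N" "f P \<in> N" "\<forall>R\<in>N - {f P}. \<Phi> R"
    using assms f_topspace[OF P] unfolding eventually_atin by blast
  have "openin X {R \<in> topspace X. f R \<in> N}"
    using openin_continuous_map_preimage[OF f_continuous N(1)] .
  moreover have "\<Phi> (f R)" if "R \<in> {R \<in> topspace X. f R \<in> N} - {P}" for R
    using that N(3) f_inj P by (auto simp: inj_on_def)
  ultimately show ?thesis unfolding eventually_atin using P N(2)
    by (intro disjI2 exI[of _ "{R \<in> topspace X. f R \<in> N}"]) blast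
qed

text \<open>The condition \<open>affine_near\<close> for all charts at once, with the translation eliminated by passing to
  increments.\<close>

definition linear_part_at :: "real mat \<Rightarrow> 'a \<Rightarrow> bool" where
  "linear_part_at B Q \<longleftrightarrow> (\<forall>V \<zeta> W \<xi>. (V, \<zeta>) \<in> \<mu> \<and> (W, \<xi>) \<in> \<mu> \<and> Q \<in> V \<and> f Q \<in> W \<longrightarrow>
     (\<forall>\<^sub>F R in nhdsin X Q. \<xi> (f R) - \<xi> (f Q) = plane_action B (\<zeta> R - \<zeta> Q)))"

text \<open>One pair of charts suffices, since changing charts does not change increments.\<close>

lemma linear_part_atI:
  assumes V: "(V, \<zeta>) \<in> \<mu>" "Q \<in> V" and W: "(W, \<xi>) \<in> \<mu>" "f Q \<in> W"
    and ev: "\<forall>\<^sub>F R in nhdsin X Q. \<xi> (f R) - \<xi> (f Q) = plane_action B (\<zeta> R - \<zeta> Q)"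
  shows "linear_part_at B Q"
  unfolding linear_part_at_def
proof (intro allI impI, elim conjE)
  fix V' \<zeta>' W' \<xi>' assume "(V', \<zeta>') \<in> \<mu>" "(W', \<xi>') \<in> \<mu>" "Q \<in> V'" "f Q \<in> W'"
  then have "\<forall>\<^sub>F R in nhdsin X Q. \<zeta>' R - \<zeta>' Q = \<zeta> R - \<zeta> Q"
    "\<forall>\<^sub>F R in nhdsin X (f Q). \<xi>' R - \<xi>' (f Q) = \<xi> R - \<xi> (f Q)"
    using translation_charts_compatible V W by blast+
  from this(1) eventually_nhdsin_f[OF this(2)] ev
  show "\<forall>\<^sub>F R in nhdsin X Q. \<xi>' (f R) - \<xi>' (f Q) = plane_action B (\<zeta>' R - \<zeta>' Q)"
    by eventually_elim simp
qed

lemma linear_part_atD: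
  assumes "linear_part_at B Q" and "(V, \<zeta>) \<in> \<mu>" "Q \<in> V" and "(W, \<xi>) \<in> \<mu>" "f Q \<in> W"
  shows "\<forall>\<^sub>F R in nhdsin X Q. \<xi> (f R) - \<xi> (f Q) = plane_action B (\<zeta> R - \<zeta> Q)"
  using assms unfolding linear_part_at_def by blast

lemma charts_at:
  assumes "Q \<in> topspace X - Z"
  obtains V \<zeta> W \<xi> where "(V, \<zeta>) \<in> \<mu>" "Q \<in> V" "(W, \<xi>) \<in> \<mu>" "f Q \<in> W"
proof -
  obtain V \<zeta> where "(V, \<zeta>) \<in> \<mu>" "Q \<in> V"
    using translation_chart_cover[of Q] assms by blast
  moreover obtain W \<xi> where "(W, \<xi>) \<in> \<mu>" "f Q \<in> W"
    using translation_chart_cover[of "f Q"] f_off_zeros[OF assms] by blast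
  ultimately show thesis by (rule that)
qed

lemma affine_near_iff:
  assumes V: "(V, \<zeta>) \<in> \<mu>" "Q \<in> V" and W: "(W, \<xi>) \<in> \<mu>" "f Q \<in> W"
  shows "affine_near X f (V, \<zeta>) (W, \<xi>) B Q \<longleftrightarrow>
    (\<forall>\<^sub>F R in nhdsin X Q. \<xi> (f R) - \<xi> (f Q) = plane_action B (\<zeta> R - \<zeta> Q))"
proof
  assume "affine_near X f (V, \<zeta>) (W, \<xi>) B Q"
  then obtain t N where N: "openin X N" "Q \<in> N" "\<forall>R\<in>N. \<xi> (f R) = plane_action B (\<zeta> R) + t"
    unfolding affine_near_def by auto
  then show "\<forall>\<^sub>F R in nhdsin X Q. \<xi> (f R) - \<xi> (f Q) = plane_action B (\<zeta> R - \<zeta> Q)"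
    unfolding eventually_nhdsin by (intro disjI2 exI[of _ N]) (simp add: plane_action_diff)
next
  have op: "openin X V" "openin X W" using V W translation_chartD(2) chart_openin by blast+
  then have "Q \<in> topspace X" using V(2) openin_subset by blast
  assume "\<forall>\<^sub>F R in nhdsin X Q. \<xi> (f R) - \<xi> (f Q) = plane_action B (\<zeta> R - \<zeta> Q)"
  then obtain N where N: "openin X N" "Q \<in> N" "\<forall>R\<in>N. \<xi> (f R) - \<xi> (f Q) = plane_action B (\<zeta> R - \<zeta> Q)"
    using \<open>Q \<in> topspace X\<close> unfolding eventually_nhdsin by blast
  let ?N = "N \<inter> V \<inter> {R \<in> topspace X. f R \<in> W}"
  have "openin X ?N"
    by (intro openin_Int N(1) op openin_continuous_map_preimage[OF f_continuous])
  moreover have "\<forall>R\<in>?N. \<xi> (f R) = plane_action B (\<zeta> R) + (\<xi> (f Q) - plane_action B (\<zeta> Q))"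
    using N(3) by (auto simp: plane_action_diff algebra_simps)
  moreover have "Q \<in> ?N" "?N \<subseteq> V" "f ` ?N \<subseteq> W"
    using N(2) V(2) W(2) \<open>Q \<in> topspace X\<close> by auto
  ultimately show "affine_near X f (V, \<zeta>) (W, \<xi>) B Q"
    unfolding affine_near_def prod.case by blast
qed

lemma linear_part_exists:
  assumes Q: "Q \<in> topspace X - Z"
  shows "\<exists>B. B \<in> SL2R \<and> linear_part_at B Q"
proof -
  obtain V \<zeta> W \<xi> where c: "(V, \<zeta>) \<in> \<mu>" "Q \<in> V" "(W, \<xi>) \<in> \<mu>" "f Q \<in> W" using charts_at[OF Q] .
  have "\<forall>\<alpha>\<in>\<mu>. \<forall>\<beta>\<in>\<mu>. \<forall>P \<in> fst \<alpha>. f P \<in> fst \<beta> \<longrightarrow> (\<exists>A\<in>SL2R. affine_near X f \<alpha> \<beta> A P)"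
    using affine by (simp add: affine_group_def)
  from bspec[OF bspec[OF this c(1)] c(3)] c(2,4)
  obtain B where "B \<in> SL2R" "affine_near X f (V, \<zeta>) (W, \<xi>) B Q" by auto
  then show ?thesis using affine_near_iff[OF c] linear_part_atI[OF c] by blast
qed

lemma linear_part_unique:
  assumes Q: "Q \<in> topspace X - Z" and A: "A \<in> SL2R" "linear_part_at A Q" and B: "B \<in> SL2R" "linear_part_at B Q"
  shows "A = B"
proof -
  obtain V \<zeta> W \<xi> where c: "(V, \<zeta>) \<in> \<mu>" "Q \<in> V" "(W, \<xi>) \<in> \<mu>" "f Q \<in> W" using charts_at[OF Q] .
  note ch = translation_chartD(2)[OF c(1)]
  from linear_part_atD[OF A(2) c] linear_part_atD[OF B(2) c]
  have "\<forall>\<^sub>F R in nhdsin X Q. plane_action A (\<zeta> R - \<zeta> Q) = plane_action B (\<zeta> R - \<zeta> Q)"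
    by eventually_elim simp
  then obtain N where N: "openin X N" "Q \<in> N" "\<forall>R\<in>N. plane_action A (\<zeta> R - \<zeta> Q) = plane_action B (\<zeta> R - \<zeta> Q)"
    using Q unfolding eventually_nhdsin by blast
  have "open (\<zeta> ` (V \<inter> N))"
    by (rule chart_open_image[OF ch]) (use N chart_openin[OF ch] in auto)
  then obtain e where e: "e > 0" "ball (\<zeta> Q) e \<subseteq> \<zeta> ` (V \<inter> N)"
    by (rule openE[of _ "\<zeta> Q"]) (use c(2) N(2) in auto)
  show ?thesis
  proof (rule plane_action_determines[OF _ _ e(1)])
    show "A \<in> carrier_mat 2 2" "B \<in> carrier_mat 2 2" using A(1) B(1) by (simp_all add: SL2R_def)
    fix z :: complex assume "z \<in> ball 0 e"
    then have "\<zeta> Q + z \<in> ball (\<zeta> Q) e" by (simp add: dist_norm)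
    then have "\<zeta> Q + z \<in> \<zeta> ` (V \<inter> N)" using e(2) by (rule subsetD[rotated])
    then obtain R where "\<zeta> Q + z = \<zeta> R" "R \<in> V \<inter> N" by (rule imageE)
    then show "plane_action A z = plane_action B z"
      using bspec[OF N(3), of R] by (metis IntD2 add_diff_cancel_left')
  qed
qed

text \<open>The same pair of charts shows the linear part at all points near \<open>Q\<close>.\<close>

lemma linear_part_nearby:
  assumes Q: "Q \<in> topspace X - Z" and B: "linear_part_at B Q"
  shows "\<forall>\<^sub>F R in nhdsin X Q. linear_part_at B R"
proof -
  obtain V \<zeta> W \<xi> where c: "(V, \<zeta>) \<in> \<mu>" "Q \<in> V" "(W, \<xi>) \<in> \<mu>" "f Q \<in> W" using charts_at[OF Q] .
  obtain N where N: "openin X N" "Q \<in> N" "\<forall>R\<in>N. \<xi> (f R) - \<xi> (f Q) = plane_action B (\<zeta> R - \<zeta> Q)"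
    using linear_part_atD[OF B c] Q unfolding eventually_nhdsin by blast
  let ?N = "N \<inter> V \<inter> {R \<in> topspace X. f R \<in> W}"
  have op: "openin X ?N"
    by (intro openin_Int N(1) openin_continuous_map_preimage[OF f_continuous]
        chart_openin[OF translation_chartD(2)[OF c(1)]] chart_openin[OF translation_chartD(2)[OF c(3)]])
  have "linear_part_at B R" if R: "R \<in> ?N" for R
  proof (rule linear_part_atI[OF c(1) _ c(3)])
    have "\<xi> (f R') - \<xi> (f R) = plane_action B (\<zeta> R' - \<zeta> R)" if "R' \<in> ?N" for R'
    proof -
      have "\<xi> (f R') - \<xi> (f R) = (\<xi> (f R') - \<xi> (f Q)) - (\<xi> (f R) - \<xi> (f Q))"
        by simp
      also have "\<dots> = plane_action B (\<zeta> R' - \<zeta> Q) - plane_action B (\<zeta> R - \<zeta> Q)"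
        using N(3) R that by auto
      also have "\<dots> = plane_action B (\<zeta> R' - \<zeta> R)" by (simp flip: plane_action_diff)
      finally show ?thesis .
    qed
    then show "\<forall>\<^sub>F R' in nhdsin X R. \<xi> (f R') - \<xi> (f R) = plane_action B (\<zeta> R' - \<zeta> R)"
      unfolding eventually_nhdsin using op R by blast
  qed (use R in auto)
  moreover have "Q \<in> ?N" using N(2) c Q by blast
  ultimately show ?thesis unfolding eventually_nhdsin using op by blast
qed

text \<open>The linear part at a point is unique and locally constant, hence the same at all points off the
  zeros. So the description in the definition of \<open>der\<close> determines a matrix, and \<open>der X \<mu> f\<close> has the
  described property.\<close>

lemma der_linear_part: "der X \<mu> f \<in> SL2R \<and> (\<forall>Q \<in> topspace X - Z. linear_part_at (der X \<mu> f) Q)"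
proof -
  define k where "k Q = (SOME B. B \<in> SL2R \<and> linear_part_at B Q)" for Q
  have k: "k Q \<in> SL2R" "linear_part_at (k Q) Q" if "Q \<in> topspace X - Z" for Q
    using someI_ex[OF linear_part_exists[OF that]] unfolding k_def by blast+
  have "\<forall>\<^sub>F R in nhdsin X Q. k R = k Q" if Q: "Q \<in> topspace X - Z" for Q
  proof -
    have "\<forall>\<^sub>F R in nhdsin X Q. R \<in> topspace X - Z"
    proof -
      obtain V \<zeta> where "(V, \<zeta>) \<in> \<mu>" "Q \<in> V"
        using translation_chart_cover[of Q] Q by blast
      with chart_openin[OF translation_chartD(2)] translation_chartD(1) show ?thesis
        unfolding eventually_nhdsin by (intro disjI2 exI[of _ V]) blast
    qed
    with linear_part_nearby[OF Q k(2)[OF Q]] show ?thesis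
    proof eventually_elim
      case (elim R)
      show ?case using linear_part_unique[OF elim(2) k[OF elim(2)] k(1)[OF Q] elim(1)] .
    qed
  qed
  from constant_off_zeros[OF this]
  have const: "k Q = k R" if "Q \<in> topspace X - Z" "R \<in> topspace X - Z" for Q R
    using that by blast
  obtain Q0 where Q0: "Q0 \<in> topspace X - Z" using nonzero_point by blast
  have iff: "(\<forall>\<alpha>\<in>\<mu>. \<forall>\<beta>\<in>\<mu>. \<forall>P \<in> fst \<alpha>. f P \<in> fst \<beta> \<longrightarrow> affine_near X f \<alpha> \<beta> B P) \<longleftrightarrow>
      (\<forall>Q \<in> topspace X - Z. linear_part_at B Q)" for B
  proof
    assume L: "\<forall>\<alpha>\<in>\<mu>. \<forall>\<beta>\<in>\<mu>. \<forall>P \<in> fst \<alpha>. f P \<in> fst \<beta> \<longrightarrow> affine_near X f \<alpha> \<beta> B P"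
    show "\<forall>Q \<in> topspace X - Z. linear_part_at B Q"
    proof
      fix Q assume "Q \<in> topspace X - Z"
      then obtain V \<zeta> W \<xi> where c: "(V, \<zeta>) \<in> \<mu>" "Q \<in> V" "(W, \<xi>) \<in> \<mu>" "f Q \<in> W" by (rule charts_at)
      have "affine_near X f (V, \<zeta>) (W, \<xi>) B Q"
        using bspec[OF bspec[OF L c(1)] c(3)] c(2,4) by simp
      then show "linear_part_at B Q" using affine_near_iff[OF c] linear_part_atI[OF c] by blast
    qed
  next
    assume R: "\<forall>Q \<in> topspace X - Z. linear_part_at B Q"
    show "\<forall>\<alpha>\<in>\<mu>. \<forall>\<beta>\<in>\<mu>. \<forall>P \<in> fst \<alpha>. f P \<in> fst \<beta> \<longrightarrow> affine_near X f \<alpha> \<beta> B P"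
    proof (intro ballI impI)
      fix \<alpha> \<beta> P assume *: "\<alpha> \<in> \<mu>" "\<beta> \<in> \<mu>" "P \<in> fst \<alpha>" "f P \<in> fst \<beta>"
      obtain V \<zeta> W \<xi> where ab: "\<alpha> = (V, \<zeta>)" "\<beta> = (W, \<xi>)"
        by (cases \<alpha>, cases \<beta>)
      with * have c: "(V, \<zeta>) \<in> \<mu>" "P \<in> V" "(W, \<xi>) \<in> \<mu>" "f P \<in> W"
        by simp_all
      have "linear_part_at B P" using R translation_chartD(1)[OF c(1)] c(2) by blast
      then show "affine_near X f \<alpha> \<beta> B P"
        using affine_near_iff[OF c] linear_part_atD[OF _ c] ab by blast
    qed
  qed
  have "der X \<mu> f = (THE B. B \<in> SL2R \<and> (\<forall>Q \<in> topspace X - Z. linear_part_at B Q))"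
    unfolding der_def iff ..
  moreover have "\<exists>!B. B \<in> SL2R \<and> (\<forall>Q \<in> topspace X - Z. linear_part_at B Q)"
  proof (rule ex1I[of _ "k Q0"])
    show "k Q0 \<in> SL2R \<and> (\<forall>Q \<in> topspace X - Z. linear_part_at (k Q0) Q)"
    proof (intro conjI ballI)
      fix Q assume Q: "Q \<in> topspace X - Z"
      show "linear_part_at (k Q0) Q" using k(2)[OF Q] unfolding const[OF Q Q0] .
    qed (rule k(1)[OF Q0])
    show "B = k Q0" if "B \<in> SL2R \<and> (\<forall>Q \<in> topspace X - Z. linear_part_at B Q)" for B
      using linear_part_unique[OF Q0 _ _ k[OF Q0]] that Q0 by blast
  qed
  from theI'[OF this] calculation show ?thesis by simp
qed

text \<open>At the points near \<open>P\<close> other than \<open>P\<close> itself, both primitives are flat and the claim is the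
  definition of the linear part. So \<open>G \<circ> f - A \<circ> F\<close> is continuous and locally constant off \<open>P\<close>, which
  settles the case that \<open>P\<close> is a zero of \<open>q\<close>.\<close>

lemma primitives_affine:
  assumes F: "(U, F) \<in> primitives" and G: "(V, G) \<in> primitives" and P: "P \<in> U" "f P \<in> V"
  shows "\<forall>\<^sub>F Q in nhdsin X P. G (f Q) - G (f P) = plane_action (der X \<mu> f) (F Q - F P)"
proof -
  let ?A = "der X \<mu> f"
  have U: "openin X U" "continuous_map (subtopology X U) euclidean F" "\<forall>\<^sub>F Q in atin X P. flat_near F Q"
    using F P unfolding primitives_def by auto
  have V: "openin X V" "continuous_map (subtopology X V) euclidean G" "\<forall>\<^sub>F Q in atin X (f P). flat_near G Q"
    using G P unfolding primitives_def by auto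
  have PX: "P \<in> topspace X" using openin_subset[OF U(1)] P(1) by blast
  let ?N = "U \<inter> {Q \<in> topspace X. f Q \<in> V}"
  have "\<forall>\<^sub>F Q in nhdsin X P. G (f Q) - plane_action ?A (F Q) = G (f P) - plane_action ?A (F P)"
  proof (rule locally_constant_removable[of ?N])
    show "openin X ?N"
      by (intro openin_Int U(1) openin_continuous_map_preimage[OF f_continuous V(1)])
    have "continuous_map (subtopology X ?N) (subtopology X V) f"
      by (rule continuous_map_into_subtopology[OF continuous_map_from_subtopology[OF f_continuous]]) auto
    from continuous_map_compose[OF this V(2)] have "continuous_map (subtopology X ?N) euclidean (\<lambda>Q. G (f Q))"
      by (simp add: o_def)
    moreover have "continuous_map (subtopology X ?N) euclidean F"
      by (rule continuous_map_from_subtopology_mono[OF U(2)]) auto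
    then have "continuous_map (subtopology X ?N) euclidean (plane_action ?A \<circ> F)"
      by (rule continuous_map_compose) (simp add: continuous_on_plane_action)
    then have "continuous_map (subtopology X ?N) euclidean (\<lambda>Q. plane_action ?A (F Q))"
      by (simp add: o_def)
    ultimately show "continuous_map (subtopology X ?N) euclidean (\<lambda>Q. G (f Q) - plane_action ?A (F Q))"
      by (rule continuous_map_diff)
    show "\<forall>\<^sub>F Q in atin X P. \<forall>\<^sub>F R in nhdsin X Q.
        G (f R) - plane_action ?A (F R) = G (f Q) - plane_action ?A (F Q)"
      using U(3) eventually_atin_f[OF PX V(3)] eventually_no_zero[of P]
    proof eventually_elim
      case (elim Q)
      show ?case
      proof (cases "Q \<in> topspace X")
        case True
        then have Q: "Q \<in> topspace X - Z" using elim(3) by blast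
        obtain V \<zeta> W \<xi> where c: "(V, \<zeta>) \<in> \<mu>" "Q \<in> V" "(W, \<xi>) \<in> \<mu>" "f Q \<in> W" using charts_at[OF Q] .
        have "linear_part_at ?A Q" using der_linear_part Q by blast
        from flat_nearD[OF elim(1) c(1,2)] eventually_nhdsin_f[OF flat_nearD[OF elim(2) c(3,4)]]
          linear_part_atD[OF this c]
        show ?thesis
        proof eventually_elim
          case (elim R)
          then have "G (f R) - G (f Q) = plane_action ?A (F R) - plane_action ?A (F Q)"
            by (simp flip: plane_action_diff)
          then show ?case by (simp add: algebra_simps)
        qed
      qed (rule eventually_nhdsin_outside)
    qed
  qed (use P PX in auto)
  then show ?thesis by eventually_elim (simp add: plane_action_diff algebra_simps)
qed

text \<open>Composing with the linear map turns a primitive along \<open>p\<close> into a primitive along \<open>f \<circ> p\<close>.\<close>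

lemma path_integral_affine:
  assumes "pathin X p"
  shows "path_integral (f \<circ> p) 0 1 = plane_action (der X \<mu> f) (path_integral p 0 1)"
proof -
  let ?A = "der X \<mu> f"
  have p: "continuous_map (top_of_set {0..1}) X p" using assms by (simp add: pathin_def)
  have fp: "continuous_map (top_of_set {0..1}) X (f \<circ> p)"
    by (rule continuous_map_compose[OF p f_continuous])
  obtain H where H: "primitive_along p {0..1} H" using primitive_along_exists[OF _ p] by auto
  have "primitive_along (f \<circ> p) {0..1} (\<lambda>t. plane_action ?A (H t))"
    unfolding primitive_along_def
  proof
    fix t :: real assume t: "t \<in> {0..1}"
    have pt: "p t \<in> topspace X" using p t by (auto simp: continuous_map_def)
    obtain U F where U: "(U, F) \<in> primitives" "p t \<in> U" using cover[OF pt] by blast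
    obtain V G where V: "(V, G) \<in> primitives" "f (p t) \<in> V"
      using cover[OF f_topspace[OF pt]] by blast
    obtain e where e: "e > 0" "\<forall>s\<in>{0..1}. dist s t < e \<longrightarrow> p s \<in> U \<and> H s - H t = F (p s) - F (p t)"
      using primitive_alongD[OF H p t U] by blast
    obtain N where N: "openin X N" "p t \<in> N" "\<forall>Q\<in>N. G (f Q) - G (f (p t)) = plane_action ?A (F Q - F (p t))"
      using primitives_affine[OF U(1) V(1) U(2) V(2)] pt unfolding eventually_nhdsin by blast
    let ?N = "N \<inter> {Q \<in> topspace X. f Q \<in> V}"
    have opN: "openin X ?N"
      by (intro openin_Int N(1) openin_continuous_map_preimage[OF f_continuous open_dom[OF V(1)]])
    have "p t \<in> ?N" using N(2) V(2) pt by simp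
    from continuous_map_nearby[OF p t opN this] obtain d where d: "d > 0" "\<And>s. s \<in> {0..1} \<Longrightarrow> dist s t < d \<Longrightarrow> p s \<in> ?N"
      by blast
    have "(f \<circ> p) s \<in> V \<and> plane_action ?A (H s) - plane_action ?A (H t) = G ((f \<circ> p) s) - G ((f \<circ> p) t)"
      if "s \<in> {0..1}" "dist s t < min d e" for s
    proof -
      have "p s \<in> ?N" using d(2)[of s] that by simp
      moreover have "H s - H t = F (p s) - F (p t)" using e(2) that by simp
      ultimately show ?thesis using N(3) by (simp flip: plane_action_diff)
    qed
    moreover have "min d e > 0" using d(1) e(1) by simp
    ultimately show "\<exists>U F e. (U, F) \<in> primitives \<and> e > 0 \<and> (\<forall>s\<in>{0..1}. dist s t < e \<longrightarrow> (f \<circ> p) s \<in> U \<and>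
        plane_action ?A (H s) - plane_action ?A (H t) = F ((f \<circ> p) s) - F ((f \<circ> p) t))"
      using V(1) by blast
  qed
  from path_integral_eq[OF _ fp this] path_integral_eq[OF _ p H] show ?thesis
    by (simp add: plane_action_diff)
qed

end

section \<open>The periods span the plane\<close>

context flat_surface begin

lemma path_connectedin_disc:
  assumes d: "disc_at P U \<phi> r"
  shows "path_connectedin X (disc U \<phi> P r)"
proof -
  let ?B = "ball (\<phi> P) r"
  have "path_connectedin (top_of_set ?B) ?B"
    by (simp add: path_connectedin_absolute convex_imp_path_connected)
  from path_connectedin_continuous_map_image[OF disc_inverse_continuous[OF d] this]
  have "path_connectedin X (inv_into U \<phi> ` ?B)" by (simp add: path_connectedin_subtopology)
  moreover have "inv_into U \<phi> ` ?B = disc U \<phi> P r"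
  proof
    show "inv_into U \<phi> ` ?B \<subseteq> disc U \<phi> P r" using disc_inverse(1)[OF d] by blast
    show "disc U \<phi> P r \<subseteq> inv_into U \<phi> ` ?B"
    proof
      fix Q assume Q: "Q \<in> disc U \<phi> P r"
      then have "\<phi> Q \<in> ?B" by (simp add: disc_def)
      from imageI[OF this, of "inv_into U \<phi>"] show "Q \<in> inv_into U \<phi> ` ?B"
        using disc_inverse_chart[OF d Q] by simp
    qed
  qed
  ultimately show ?thesis by simp
qed

lemma open_primitive_exists:
  assumes "openin X N" and "P \<in> N"
  shows "\<exists>D F. (D, F) \<in> primitives \<and> P \<in> D \<and> D \<subseteq> N \<and> path_connectedin X D \<and>
    (\<forall>W. openin X W \<and> W \<subseteq> D \<longrightarrow> open (F ` W))"
proof -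
  obtain U \<phi> r where d: "disc_at P U \<phi> r" "disc U \<phi> P r \<subseteq> N"
    using disc_exists[OF assms] by blast
  obtain F where "(disc U \<phi> P r, F) \<in> primitives" "\<forall>W. openin X W \<and> W \<subseteq> disc U \<phi> P r \<longrightarrow> open (F ` W)"
    using primitive_on_disc[OF d(1)] by blast
  then show ?thesis using d(2) centre_in_disc[OF d(1)] path_connectedin_disc[OF d(1)] by blast
qed

lemma path_connected_surface: "path_connected_space X"
proof -
  have "locally_path_connected_space X"
    unfolding locally_path_connected_space
  proof (intro allI impI, elim conjE)
    fix N P assume "openin X N" "P \<in> N"
    then obtain D F where "(D, F) \<in> primitives" "P \<in> D" "D \<subseteq> N" "path_connectedin X D"
      using open_primitive_exists by meson
    then show "\<exists>U. openin X U \<and> path_connectedin X U \<and> P \<in> U \<and> U \<subseteq> N" using open_dom by blast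
  qed
  then show ?thesis using connected_surface path_connected_eq_connected_space by blast
qed

text \<open>Suppose the linear form \<open>L\<close> with the coefficients \<open>\<alpha>, \<beta>\<close> vanishes on all periods. Then \<open>L\<close> of the integral
  along any path from \<open>x\<close> to \<open>y\<close> is a function \<open>h\<close> of \<open>y\<close>. It is locally \<open>L \<circ> F\<close> up to a constant,
  with \<open>F\<close> an open local primitive. So it is continuous, attains its maximum, and yet increases in
  some direction at every point.\<close>

lemma periods_span_plane:
  fixes \<alpha> \<beta> :: real
  assumes x: "x \<in> topspace X" and nz: "\<alpha> \<noteq> 0 \<or> \<beta> \<noteq> 0"
  shows "\<exists>p \<in> loops X x. \<alpha> * Re (path_integral p 0 1) + \<beta> * Im (path_integral p 0 1) \<noteq> 0"
proof (rule ccontr)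
  define L where "L w = \<alpha> * Re w + \<beta> * Im w" for w
  have L_add: "L (v + w) = L v + L w" and L_diff: "L (v - w) = L v - L w" for v w
    by (simp_all add: L_def algebra_simps)
  assume "\<not> ?thesis"
  then have loops0: "L (path_integral p 0 1) = 0" if "p \<in> loops X x" for p
    using that by (auto simp: L_def)
  have "\<exists>p. pathin X p \<and> p 0 = x \<and> p 1 = y" if "y \<in> topspace X" for y
    using path_connected_surface x that unfolding path_connected_space_def by blast
  then obtain \<gamma> where \<gamma>: "\<And>y. y \<in> topspace X \<Longrightarrow> pathin X (\<gamma> y) \<and> \<gamma> y 0 = x \<and> \<gamma> y 1 = y"
    by metis
  define h where "h y = L (path_integral (\<gamma> y) 0 1)" for y
  have h_local: "h z - h y = L (F z - F y)"
    if F: "(D, F) \<in> primitives" and D: "path_connectedin X D" and yz: "y \<in> D" "z \<in> D"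
      for D F y z
  proof -
    have top: "y \<in> topspace X" "z \<in> topspace X"
      using openin_subset[OF open_dom[OF F]] yz by blast+
    obtain l where l: "pathin X l" "l \<in> {0..1} \<rightarrow> D" "l 0 = y" "l 1 = z"
      using D yz unfolding path_connectedin by blast
    define r where "r = (\<lambda>t. \<gamma> z (1 - t))"
    have r: "pathin X r" "r 0 = z" "r 1 = x" "path_integral r 0 1 = - path_integral (\<gamma> z) 0 1"
      using \<gamma>[OF top(2)] pathin_reverse[of X "\<gamma> z"] path_integral_reverse[of "\<gamma> z"]
      by (simp_all add: r_def)
    let ?j = "loop_join (\<gamma> y) l"
    have j: "pathin X ?j" "path_integral ?j 0 1 = path_integral (\<gamma> y) 0 1 + path_integral l 0 1"
      using pathin_join[of X "\<gamma> y" l] path_integral_join[of "\<gamma> y" l] \<gamma>[OF top(1)] l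
        by simp_all
    have j1: "?j 0 = x" "?j 1 = z" using \<gamma>[OF top(1)] l(4) by (simp_all add: loop_join_def)
    have "loop_join ?j r \<in> loops X x"
      using pathin_join[OF j(1) r(1)] j1 r(2,3)
        unfolding loops_def by (simp add: loop_join_def[of ?j r])
    moreover have "path_integral (loop_join ?j r) 0 1 =
        path_integral (\<gamma> y) 0 1 + path_integral l 0 1 - path_integral (\<gamma> z) 0 1"
      using path_integral_join[OF j(1) r(1)] j(2) j1(2) r(2,4) by simp
    moreover have "path_integral l 0 1 = F z - F y"
      using path_integral_in_domain[OF _ l(1)[unfolded pathin_def] F] l(2,3,4) by (auto simp: Pi_iff)
    ultimately have "L (path_integral (\<gamma> y) 0 1 + (F z - F y) - path_integral (\<gamma> z) 0 1) = 0"
      using loops0 by metis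
    then show ?thesis by (simp add: h_def L_add L_diff)
  qed
  have "continuous_map X euclideanreal h"
    unfolding continuous_map_def
  proof (intro conjI allI impI)
    fix B :: "real set" assume B: "openin euclideanreal B"
    show "openin X {y \<in> topspace X. h y \<in> B}"
    proof (subst openin_subopen, intro ballI)
      fix y assume y: "y \<in> {y \<in> topspace X. h y \<in> B}"
      then obtain D F where F: "(D, F) \<in> primitives" "y \<in> D" "path_connectedin X D"
        using open_primitive_exists[OF openin_topspace, of y] by blast
      have D: "openin X D" "continuous_map (subtopology X D) euclidean F"
        using F(1) by (simp_all add: primitives_def)
      have "continuous_map euclidean euclideanreal (\<lambda>w. h y + L (w - F y))"
        by (simp add: L_def) (intro continuous_intros)
      from continuous_map_compose[OF D(2) this]
      have "continuous_map (subtopology X D) euclideanreal (\<lambda>z. h y + L (F z - F y))"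
        by (simp add: o_def)
      then have "continuous_map (subtopology X D) euclideanreal h"
      proof (rule continuous_map_eq)
        fix z assume "z \<in> topspace (subtopology X D)"
        then have "z \<in> D" by simp
        from h_local[OF F(1,3,2) this] show "h y + L (F z - F y) = h z" by simp
      qed
      from openin_continuous_map_preimage[OF this B]
      have "openin X {z \<in> topspace (subtopology X D). h z \<in> B}"
        using D(1) by (simp only: openin_open_subtopology)
      then show "\<exists>T. openin X T \<and> y \<in> T \<and> T \<subseteq> {y \<in> topspace X. h y \<in> B}"
        using y F(2) by (intro exI[of _ "{z \<in> topspace (subtopology X D). h z \<in> B}"]) auto
    qed
  qed simp
  then have "compact (h ` topspace X)"
    using image_compactin[of X "topspace X" euclideanreal h] compact_surface
      by (simp add: compact_space_def)
  moreover have "h ` topspace X \<noteq> {}" using surface_nonempty by simp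
  ultimately obtain P where P: "P \<in> topspace X" "\<And>y. y \<in> topspace X \<Longrightarrow> h y \<le> h P"
    using compact_attains_sup[of "h ` topspace X"] by auto
  obtain D F where F: "(D, F) \<in> primitives" "P \<in> D" "path_connectedin X D"
    and op: "\<forall>W. openin X W \<and> W \<subseteq> D \<longrightarrow> open (F ` W)"
    using open_primitive_exists[OF openin_topspace P(1)] by blast
  have "open (F ` D)" using op open_dom[OF F(1)] by blast
  then obtain e where e: "e > 0" "ball (F P) e \<subseteq> F ` D"
    by (rule openE[of _ "F P"]) (use F(2) in auto)
  \<comment> \<open>The gradient direction of \<open>L\<close>, scaled to stay inside the ball.\<close>
  define w where "w = Complex \<alpha> \<beta>"
  have w: "norm w > 0" using nz by (simp add: w_def complex_eq_iff)
  define c where "c = e / (2 * norm w)"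
  have c: "c > 0" "c * norm w = e / 2" using w e(1) by (simp_all add: c_def)
  define v where "v = of_real c * w"
  have "norm v = e / 2" using c by (simp add: v_def norm_mult)
  then have "F P + v \<in> ball (F P) e" using e(1) by (simp add: dist_norm)
  then have "F P + v \<in> F ` D" using e(2) by (rule subsetD[rotated])
  then obtain y where y: "F P + v = F y" "y \<in> D" by (rule imageE)
  have "L v = c * (\<alpha>\<^sup>2 + \<beta>\<^sup>2)"
    by (simp add: L_def v_def w_def power2_eq_square algebra_simps)
  moreover have "\<alpha>\<^sup>2 + \<beta>\<^sup>2 > 0" using nz by (simp add: sum_power2_gt_zero_iff)
  ultimately have "L v > 0" using c(1) by simp
  moreover have "h y - h P = L v"
  proof -
    have "F y - F P = v" using y(1)[symmetric] by simp
    then show ?thesis using h_local[OF F(1,3,2) y(2)] by simp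
  qed
  moreover have "y \<in> topspace X" using openin_subset[OF open_dom[OF F(1)]] y(2) by blast
  ultimately show False using P(2)[of y] by simp
qed

end

section \<open>Eigenvalues of the homology matrix\<close>

lemma eigenvalue_iff_left_eigenvector:
  fixes N :: "'k :: field mat"
  assumes N: "N \<in> carrier_mat n n"
  shows "eigenvalue N z \<longleftrightarrow>
    (\<exists>v. (\<exists>i<n. v i \<noteq> 0) \<and> (\<forall>j<n. (\<Sum>i<n. v i * N $$ (i, j)) = z * v j))"
proof -
  have T: "transpose_mat N \<in> carrier_mat n n" using N by simp
  have "eigenvalue N z \<longleftrightarrow> eigenvalue (transpose_mat N) z"
    using eigenvalue_root_char_poly[OF N] eigenvalue_root_char_poly[OF T] char_poly_transpose_mat[OF N]
      by simp
  also have "\<dots> \<longleftrightarrow> (\<exists>v. (\<exists>i<n. v i \<noteq> 0) \<and> (\<forall>j<n. (\<Sum>i<n. v i * N $$ (i, j)) = z * v j))"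
  proof
    assume "eigenvalue (transpose_mat N) z"
    then obtain x where x: "x \<in> carrier_vec n" "x \<noteq> 0\<^sub>v n" "transpose_mat N *\<^sub>v x = z \<cdot>\<^sub>v x"
      using N by (auto simp: eigenvalue_def eigenvector_def)
    have "\<exists>i<n. vec_index x i \<noteq> 0"
      using x(1,2) by (metis carrier_vecD eq_vecI index_zero_vec(1,2))
    moreover have "(\<Sum>i<n. vec_index x i * N $$ (i, j)) = z * vec_index x j" if j: "j < n" for j
    proof -
      have "vec_index (transpose_mat N *\<^sub>v x) j = vec_index (z \<cdot>\<^sub>v x) j"
        using x(3) by simp
      then show ?thesis using j N x(1)
        by (simp add: scalar_prod_def mult.commute lessThan_atLeast0)
    qed
    ultimately show "\<exists>v. (\<exists>i<n. v i \<noteq> 0) \<and> (\<forall>j<n. (\<Sum>i<n. v i * N $$ (i, j)) = z * v j)"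
      by (intro exI[of _ "vec_index x"]) simp
  next
    assume "\<exists>v. (\<exists>i<n. v i \<noteq> 0) \<and> (\<forall>j<n. (\<Sum>i<n. v i * N $$ (i, j)) = z * v j)"
    then obtain v i where v: "i < n" "v i \<noteq> 0" "\<And>j. j < n \<Longrightarrow> (\<Sum>i<n. v i * N $$ (i, j)) = z * v j" by blast
    have "vec n v \<noteq> 0\<^sub>v n"
    proof
      assume "vec n v = 0\<^sub>v n"
      then have "vec_index (vec n v) i = vec_index (0\<^sub>v n) i" by simp
      then show False using v(1,2) by simp
    qed
    moreover have "transpose_mat N *\<^sub>v vec n v = z \<cdot>\<^sub>v vec n v"
    proof (rule eq_vecI)
      fix j assume "j < dim_vec (z \<cdot>\<^sub>v vec n v)"
      then have j: "j < n" by simp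
      then show "vec_index (transpose_mat N *\<^sub>v vec n v) j = vec_index (z \<cdot>\<^sub>v vec n v) j"
        using N v(3)[OF j] by (simp add: scalar_prod_def mult.commute lessThan_atLeast0)
    qed (use N in simp)
    ultimately show "eigenvalue (transpose_mat N) z"
      using N unfolding eigenvalue_def eigenvector_def by (intro exI[of _ "vec n v"]) simp
  qed
  finally show ?thesis .
qed

theorem theorem5p7:
  fixes X :: "'a topology"
    and \<A> :: "'a chart set"
    and q :: "'a chart \<Rightarrow> complex \<Rightarrow> complex"
    and \<mu> :: "'a chart set"
    and g :: nat
    and x\<^sub>0 :: 'a
    and a b :: "nat \<Rightarrow> real \<Rightarrow> 'a"
    and f :: "'a \<Rightarrow> 'a"
    and A :: "real mat"
    and M :: "int mat"
    and z :: complex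
  assumes "translation_surface X \<A> q \<mu>"
    and "has_genus X g" and "g \<ge> 2"
    and "x\<^sub>0 \<in> topspace X" and "standard_generators X x\<^sub>0 g a b"
    and "f \<in> affine_group X \<mu>" and "A = der X \<mu> f"
    and "is_homology_matrix X g a b f M"
    and "eigenvalue (map_mat complex_of_real A) z"
  shows "eigenvalue (map_mat (of_int :: int \<Rightarrow> complex) M) z"
proof -
  interpret affine_map X \<A> q \<mu> f
    by unfold_locales (use assms(1,6) in auto)
  let ?c = "generator_family g a b"
  define \<omega> where "\<omega> j = path_integral (?c j) 0 1" for j
  have A: "A \<in> carrier_mat 2 2" using der_linear_part assms(7) by (simp add: SL2R_def)
  have M: "M \<in> carrier_mat (2 * g) (2 * g)" using assms(8) by (simp add: is_homology_matrix_def)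
  have pres: "has_presentation (fundamental_group X x\<^sub>0) {..<2*g} (\<lambda>j. homotopy_class X x\<^sub>0 (?c j)) {surface_relator g}"
    using assms(5) by (simp add: standard_generators_def)
  have loop: "?c j \<in> loops X x\<^sub>0" if "j < 2 * g" for j
    using assms(5) that by (simp add: standard_generators_def generator_family_def)
  have period_relation: "plane_action A (\<omega> j) = (\<Sum>i<2*g. of_int (M $$ (i, j)) * \<omega> i)"
    if j: "j < 2 * g" for j
  proof -
    have "path_integral (f \<circ> ?c j) 0 1 = (\<Sum>i<2*g. of_int (M $$ (i, j)) * path_integral (?c i) 0 1)"
    proof (rule path_integral_induced[OF f_continuous loop[OF j]])
      show "hom_induced 1 X {} X {} f (loop_class X (?c j)) = finprod (homology_group 1 X)
          (\<lambda>i. loop_class X (?c i) [^]\<^bsub>homology_group 1 X\<^esub> (M $$ (i, j))) {..<2*g}"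
        using assms(8) j by (simp add: is_homology_matrix_def)
    qed (use loop in auto)
    moreover have "pathin X (?c j)" using loop[OF j] by (simp add: loops_def)
    ultimately show ?thesis using path_integral_affine assms(7) by (simp add: \<omega>_def)
  qed
  obtain v where v: "\<exists>i<2. v i \<noteq> 0"
    "\<And>j. j < 2 \<Longrightarrow> (\<Sum>i<2. v i * map_mat complex_of_real A $$ (i, j)) = z * v j"
    using assms(9) eigenvalue_iff_left_eigenvector[of "map_mat complex_of_real A" 2 z] A by auto
  have v0: "v 0 * of_real (A $$ (0, 0)) + v 1 * of_real (A $$ (1, 0)) = z * v 0"
    and v1: "v 0 * of_real (A $$ (0, 1)) + v 1 * of_real (A $$ (1, 1)) = z * v 1"
    using v(2)[of 0] v(2)[of 1] A by (simp_all add: numeral_2_eq_2)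
  \<comment> \<open>\<open>L\<close> is the left eigenvector \<open>v\<close> of \<open>A\<close> as a complex-valued form on the plane; the values \<open>L (\<omega> j)\<close>
    are the entries of the left eigenvector of \<open>M\<close>.\<close>
  define L where "L w = v 0 * of_real (Re w) + v 1 * of_real (Im w)" for w
  have L_sum: "L (\<Sum>i\<in>I. of_int (m i) * w i) = (\<Sum>i\<in>I. L (w i) * of_int (m i))"
    for I m and w :: "nat \<Rightarrow> complex"
    by (simp add: L_def sum.distrib sum_distrib_left algebra_simps)
  have L_diff: "L (w - w') = L w - L w'" for w w' by (simp add: L_def algebra_simps)
  have L_A: "L (plane_action A w) = z * L w" for w
  proof -
    have "L (plane_action A w) = (v 0 * of_real (A $$ (0, 0)) + v 1 * of_real (A $$ (1, 0))) * of_real (Re w)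
        + (v 0 * of_real (A $$ (0, 1)) + v 1 * of_real (A $$ (1, 1))) * of_real (Im w)"
      by (simp add: L_def plane_action_def algebra_simps)
    also have "\<dots> = z * L w" unfolding v0 v1 by (simp add: L_def algebra_simps)
    finally show ?thesis .
  qed
  have "\<exists>j<2*g. L (\<omega> j) \<noteq> 0"
  proof (rule ccontr)
    assume "\<not> ?thesis"
    then have zero: "L (\<omega> j) = 0" if "j < 2 * g" for j using that by blast
    have "L (path_integral p 0 1) = 0" if p: "p \<in> loops X x\<^sub>0" for p
    proof -
      have "path_integral p 0 1 \<in> {w. L w = 0}"
        by (rule path_integral_in_subgroup[OF Hausdorff_surface assms(4) pres _ _ _ _ p])
           (use loop zero L_diff in \<open>auto simp: \<omega>_def L_def\<close>)
      then show ?thesis by simp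
    qed
    \<comment> \<open>The real and the imaginary part of \<open>v\<close> are real linear forms, at least one of them nonzero.\<close>
    then have parts: "Re (v 0) * Re (path_integral p 0 1) + Re (v 1) * Im (path_integral p 0 1) = 0"
      "Im (v 0) * Re (path_integral p 0 1) + Im (v 1) * Im (path_integral p 0 1) = 0"
      if "p \<in> loops X x\<^sub>0" for p
      using that by (simp_all add: L_def complex_eq_iff)
    have "v 0 \<noteq> 0 \<or> v 1 \<noteq> 0" using v(1) by (auto simp: less_2_cases_iff)
    then consider "Re (v 0) \<noteq> 0 \<or> Re (v 1) \<noteq> 0" | "Im (v 0) \<noteq> 0 \<or> Im (v 1) \<noteq> 0"
      by (auto simp: complex_eq_iff)
    then show False
      using periods_span_plane[OF assms(4)] parts by cases blast+
  qed
  moreover have "(\<Sum>i<2*g. L (\<omega> i) * map_mat of_int M $$ (i, j)) = z * L (\<omega> j)"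
    if "j < 2 * g" for j
    using period_relation[OF that] L_A[of "\<omega> j"] L_sum[of "\<lambda>i. M $$ (i, j)" \<omega> "{..<2*g}"] M that by simp
  ultimately show ?thesis
    using eigenvalue_iff_left_eigenvector[of "map_mat of_int M" "2 * g" z] M by auto
qed

end
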